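(* Let $T$ be an $n$-vertex forest. Then $\mathring{s}(T)\le\lfloor 3n/2\rfloor$. Furthermore, equality holds if and only if $T$ contains a spanning forest $F$ such that: if $n$ is even, every vertex of $F$ has degree $1$ or $3$ in $F$; if $n$ is odd, exactly one vertex of $F$ has degree $0$ or $6$ in $F$ and every other vertex has degree $1$ or $3$ in $F$.
   Context: Slow-coloring game on a finite graph $G$: in each round Lister marks a nonempty set $M$ of currently uncolored vertices, scoring $|M|$ points; Painter then colors a subset of $M$ independent in $G$. The game ends when all vertices are colored. Painter minimizes and Lister maximizes the total score; the sum-color cost $\mathring{s}(G)$ is the value of the game. A spanning forest of $T$ is a subgraph with vertex set $V(T)$ that is a forest. *)

theory Defs
  imports Main
begin

section \<open>Finite simple graphs and forests\<close>

text \<open>A graph is given by a vertex set \<open>V\<close> and a set \<open>E\<close> of two-element sets (the edges).\<close>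

definition simple_graph :: "'a set \<Rightarrow> 'a set set \<Rightarrow> bool" where
  "simple_graph V E \<longleftrightarrow> finite V \<and> (\<forall>e\<in>E. e \<subseteq> V \<and> card e = 2)"

definition degree :: "'a set set \<Rightarrow> 'a \<Rightarrow> nat" where
  "degree E v = card {e \<in> E. v \<in> e}"

definition independent :: "'a set set \<Rightarrow> 'a set \<Rightarrow> bool" where
  "independent E I \<longleftrightarrow> (\<forall>u\<in>I. \<forall>v\<in>I. {u, v} \<notin> E)"

text \<open>A cycle is listed once around, without repeating its first vertex at the end.\<close>

definition is_cycle :: "'a set set \<Rightarrow> 'a list \<Rightarrow> bool" where
  "is_cycle E vs \<longleftrightarrow> 3 \<le> length vs \<and> distinct vs \<and>
     (\<forall>i<length vs. {vs ! i, vs ! (Suc i mod length vs)} \<in> E)"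

definition forest :: "'a set \<Rightarrow> 'a set set \<Rightarrow> bool" where
  "forest V E \<longleftrightarrow> simple_graph V E \<and> \<not> (\<exists>vs. is_cycle E vs)"

text \<open>A spanning forest of \<open>(V, E)\<close> has vertex set \<open>V\<close>, so it is given by its edge set \<open>F\<close>.\<close>

definition spanning_forest :: "'a set \<Rightarrow> 'a set set \<Rightarrow> 'a set set \<Rightarrow> bool" where
  "spanning_forest V E F \<longleftrightarrow> F \<subseteq> E \<and> forest V F"


section \<open>The slow-coloring game\<close>

text \<open>
  In both predicates \<open>U\<close> is the set of currently uncolored vertices.
  \<open>painter_holds E U k\<close>: from this position Painter can make the game end with Lister scoring
  at most \<open>k\<close> further points.
  \<open>lister_forces E U k\<close>: from this position Lister can score at least \<open>k\<close> further points.
  Painter may answer with the empty set. Each round scores at least one point, so a play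
  in which Painter never finishes coloring exceeds every bound.
\<close>

inductive painter_holds :: "'a set set \<Rightarrow> 'a set \<Rightarrow> nat \<Rightarrow> bool" for E where
  "(\<And>M. M \<subseteq> U \<Longrightarrow> M \<noteq> {} \<Longrightarrow>
      card M \<le> k \<and> (\<exists>I\<subseteq>M. independent E I \<and> painter_holds E (U - I) (k - card M)))
   \<Longrightarrow> painter_holds E U k"

text \<open>In the second rule below, the truncated \<open>k - card M\<close> is \<open>0\<close> if the mark itself already
  yields the \<open>k\<close> points.\<close>

inductive lister_forces :: "'a set set \<Rightarrow> 'a set \<Rightarrow> nat \<Rightarrow> bool" for E where
  "lister_forces E U 0"
| "M \<subseteq> U \<Longrightarrow> M \<noteq> {} \<Longrightarrow>
     (\<And>I. I \<subseteq> M \<Longrightarrow> independent E I \<Longrightarrow> lister_forces E (U - I) (k - card M))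
   \<Longrightarrow> lister_forces E U k"

text \<open>The value of the game: the score that both players can guarantee.\<close>

definition sum_color_cost :: "'a set \<Rightarrow> 'a set set \<Rightarrow> nat" where
  "sum_color_cost V E = (THE k. painter_holds E V k \<and> lister_forces E V k)"


subsection \<open>The value is well defined\<close>

lemma lister_forces_mono:
  "lister_forces E U k \<Longrightarrow> j \<le> k \<Longrightarrow> lister_forces E U j"
proof (induction arbitrary: j rule: lister_forces.induct)
  case (1 U)
  then show ?case by (simp add: lister_forces.intros(1))
next
  case (2 M U k)
  show ?case
    by (rule lister_forces.intros(2)[OF 2(1,2)]) (simp add: 2 diff_le_mono)
qed

lemma game_determined:
  assumes "finite U"
  shows "painter_holds E U k \<longleftrightarrow> \<not> lister_forces E U (Suc k)"
  using assms
proof (induction k arbitrary: U rule: less_induct)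
  case (less k)
  have step: "painter_holds E (U - I) (k - card M) \<longleftrightarrow> \<not> lister_forces E (U - I) (Suc k - card M)"
    if "M \<subseteq> U" "M \<noteq> {}" "card M \<le> k" for M I
  proof -
    have "card M > 0" using that less.prems by (meson card_gt_0_iff finite_subset)
    then have "k - card M < k" using that by linarith
    from less.IH[OF this, of "U - I"] show ?thesis
      using that less.prems by (simp add: Suc_diff_le)
  qed
  show ?case
  proof
    assume p: "painter_holds E U k"
    show "\<not> lister_forces E U (Suc k)"
    proof
      assume "lister_forces E U (Suc k)"
      then obtain M where M: "M \<subseteq> U" "M \<noteq> {}"
        "\<And>I. I \<subseteq> M \<Longrightarrow> independent E I \<Longrightarrow> lister_forces E (U - I) (Suc k - card M)"
        by (cases rule: lister_forces.cases) auto
      from p M(1,2) obtain I where "card M \<le> k" "I \<subseteq> M" "independent E I"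
        "painter_holds E (U - I) (k - card M)"
        by (cases rule: painter_holds.cases) blast
      with M step show False by blast
    qed
  next
    assume l: "\<not> lister_forces E U (Suc k)"
    show "painter_holds E U k"
    proof (rule painter_holds.intros)
      fix M assume M: "M \<subseteq> U" "M \<noteq> {}"
      from l lister_forces.intros(2)[OF M, of E "Suc k"]
      obtain I where I: "I \<subseteq> M" "independent E I"
        "\<not> lister_forces E (U - I) (Suc k - card M)" by blast
      have "card M \<le> k"
      proof (rule ccontr)
        assume "\<not> card M \<le> k"
        then have "Suc k - card M = 0" by simp
        with I(3) show False by (simp add: lister_forces.intros(1))
      qed
      with I M step
      show "card M \<le> k \<and> (\<exists>I\<subseteq>M. independent E I \<and> painter_holds E (U - I) (k - card M))"
        by blast
    qed
  qed
qed

lemma painter_holds_bound: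
  assumes "finite U" "\<forall>v\<in>U. {v} \<notin> E" "card U * card U \<le> k"
  shows "painter_holds E U k"
  using assms
proof (induction "card U" arbitrary: U k rule: less_induct)
  case less
  show ?case
  proof (rule painter_holds.intros)
    fix M assume M: "M \<subseteq> U" "M \<noteq> {}"
    then obtain v where v: "v \<in> M" by blast
    have c: "card M \<le> card U" using M less.prems by (simp add: card_mono)
    have "v \<in> U" using v M by blast
    then have cv: "card (U - {v}) = card U - 1" "card U > 0"
      using less.prems by (auto simp: card_gt_0_iff)
    have "(card U - 1) * (card U - 1) + card U \<le> card U * card U"
      using cv(2) by (cases "card U") auto
    then have k: "card M \<le> k" "card (U - {v}) * card (U - {v}) \<le> k - card M"
      using c cv(1) less.prems(3) by auto
    have "painter_holds E (U - {v}) (k - card M)"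
      by (rule less.hyps) (use cv less.prems k in auto)
    moreover have "independent E {v}"
      using less.prems(2) \<open>v \<in> U\<close> by (simp add: independent_def)
    ultimately show "card M \<le> k \<and> (\<exists>I\<subseteq>M. independent E I \<and> painter_holds E (U - I) (k - card M))"
      using k(1) v by blast
  qed
qed

lemma game_value_ex1:
  assumes "simple_graph V E"
  shows "\<exists>!k. painter_holds E V k \<and> lister_forces E V k"
proof -
  have fin: "finite V" using assms by (simp add: simple_graph_def)
  have "\<forall>v\<in>V. {v} \<notin> E" using assms by (force simp: simple_graph_def)
  then have ex: "\<exists>k. painter_holds E V k" using painter_holds_bound[OF fin] by blast
  define m where "m = (LEAST k. painter_holds E V k)"
  have pm: "painter_holds E V m" unfolding m_def using ex by (rule LeastI_ex)
  have lm: "lister_forces E V m"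
  proof (cases m)
    case 0
    then show ?thesis by (simp add: lister_forces.intros(1))
  next
    case (Suc j)
    then have "\<not> painter_holds E V j"
      unfolding m_def using not_less_Least[of j "painter_holds E V"] by simp
    with Suc show ?thesis using game_determined[OF fin] by blast
  qed
  have "\<not> j < k" if "painter_holds E V j" "lister_forces E V k" for j k
    using that game_determined[OF fin] lister_forces_mono[of E V k "Suc j"] by auto
  with pm lm show ?thesis by (meson linorder_neqE_nat)
qed

end

theory Submission
  imports Defs
begin

text \<open>
  Painter: \<open>r\<close> leaves attached at a vertex \<open>v\<close> cost at most \<open>r + c\<close> and a star with \<open>r\<close> leaves hung
  on the graph by one edge costs at most \<open>r + 1 + c\<close>, where \<open>c\<close> is about the square root of \<open>2 * r\<close>.
  A forest with an edge has a vertex with \<open>r \<ge> 1\<close> leaves and at most one further neighbor;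
  removing the leaves or the star gives the bound by induction, and the cases in which nothing
  is lost are \<open>r \<le> 6\<close>, where a spanning forest for the smaller graph extends to one for the larger.

  Lister: in a forest with all degrees at most 3, except possibly one vertex of degree 6, Lister can
  score \<open>(3 * n - z) / 2\<close>, where \<open>z\<close> is the number of vertices of even degree.
\<close>

text \<open>Parity governs when nothing is lost. For \<open>r = 1, 2, 3\<close> Painter deletes an
  even number of vertices at exactly 3/2 points each. For \<open>r = 4, 5, 6\<close> the number is
  odd and half a point is saved. The floor hides that half point once, and only if the order becomes
  odd; a second odd step makes the bound strict. So a tight sequence of deletions has at most one
  odd step, and this step creates the exceptional vertex: a leaf left isolated for
  \<open>r = 4\<close>, or a vertex of degree 6 with 5 or 6 new leaves. If there is no odd step, an
  odd order stems from a single vertex at the end. From \<open>r = 7\<close> on a whole point is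
  saved.

  For Lister, \<open>3 * n - z\<close> is a potential in which an even vertex counts half a point
  less than an odd one. Degree 6 fits because a center with six leaves, marked with three of them,
  makes Painter's two answers equally good: removing three leaves makes its degree odd, and removing
  the center leaves six isolated vertices.\<close>

definition nbrs :: "'a set set \<Rightarrow> 'a set \<Rightarrow> 'a \<Rightarrow> 'a set" where
  "nbrs E U v = {w \<in> U. {v, w} \<in> E}"

lemma in_nbrs [simp]: "w \<in> nbrs E U v \<longleftrightarrow> w \<in> U \<and> {v, w} \<in> E"
  by (simp add: nbrs_def)

lemma finite_nbrs [simp]: "finite U \<Longrightarrow> finite (nbrs E U v)"
  by (simp add: nbrs_def)

text \<open>Positions of the game change the vertex set but keep \<open>E\<close>, so acyclicity is
  stated for the edge set alone. Loops are excluded separately because \<open>is_cycle\<close>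
  starts at length 3 and a vertex with a loop could never be colored.\<close>

definition acyclic_edges :: "'a set set \<Rightarrow> bool" where
  "acyclic_edges E \<longleftrightarrow> (\<forall>x. {x} \<notin> E) \<and> (\<nexists>vs. is_cycle E vs)"

lemma acyclic_edges_subset: "acyclic_edges E \<Longrightarrow> F \<subseteq> E \<Longrightarrow> acyclic_edges F"
  unfolding acyclic_edges_def is_cycle_def by blast

section \<open>Longest paths and pendant stars\<close>

lemma is_cycleI:
  assumes "successively (\<lambda>x y. {x, y} \<in> E) vs" "distinct vs" "3 \<le> length vs"
    and "{last vs, hd vs} \<in> E"
  shows "is_cycle E vs"
  unfolding is_cycle_def
proof (intro conjI allI impI assms)
  fix i assume i: "i < length vs"
  show "{vs ! i, vs ! (Suc i mod length vs)} \<in> E"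
  proof (cases "Suc i < length vs")
    case True
    then show ?thesis using assms(1) by (simp add: successively_conv_nth)
  next
    case False
    with i have "Suc i = length vs" "vs \<noteq> []" by auto
    then show ?thesis using assms(4) by (simp add: last_conv_nth hd_conv_nth flip: \<open>Suc i = length vs\<close>)
  qed
qed

text \<open>An edge from the start of a path to a vertex beyond the second would close the segment
  in between into a cycle.\<close>

lemma no_chord:
  assumes "acyclic_edges E" "successively (\<lambda>x y. {x, y} \<in> E) (x # xs)" "distinct (x # xs)"
    and "y \<in> set xs" "{x, y} \<in> E"
  shows "y = hd xs"
proof -
  from assms(4) obtain as bs where xs: "xs = as @ y # bs" by (meson split_list)
  show ?thesis
  proof (cases as)
    case Nil
    then show ?thesis using xs by simp
  next
    case (Cons a as')
    have "x # xs = (x # as @ [y]) @ bs" using xs by simp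
    then have "successively (\<lambda>x y. {x, y} \<in> E) (x # as @ [y])"
      using assms(2) by (metis successively_append_iff)
    moreover have "distinct (x # as @ [y])" using assms(3) xs by auto
    ultimately have "is_cycle E (x # as @ [y])"
      by (rule is_cycleI) (use Cons assms(5) in \<open>auto simp: insert_commute\<close>)
    then show ?thesis using assms(1) by (auto simp: acyclic_edges_def)
  qed
qed

text \<open>Take a longest path from \<open>s\<close>: its last vertex is a leaf, and so is every other
  continuation of the path from the penultimate vertex.\<close>

lemma stem_exists:
  assumes ac: "acyclic_edges E" and fin: "finite U" and s: "s \<in> U" "nbrs E U s \<noteq> {}"
  shows "(\<forall>x\<in>nbrs E U s. nbrs E U x = {s}) \<or>
    (\<exists>v p. v \<in> U \<and> v \<noteq> s \<and> p \<in> nbrs E U v \<and> nbrs E U v \<noteq> {p} \<and>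
       (\<forall>x\<in>nbrs E U v - {p}. nbrs E U x = {v}))"
proof -
  \<comment> \<open>Paths are listed from the far end back to \<open>s\<close>, so that prolonging
    one is a \<open>#\<close>.\<close>
  define P where "P xs \<longleftrightarrow> distinct xs \<and> set xs \<subseteq> U \<and> successively (\<lambda>x y. {x, y} \<in> E) xs \<and>
    xs \<noteq> [] \<and> last xs = s" for xs
  have Pext: "P (z # x # ys)" if "P (x # ys)" "z \<in> U" "{z, x} \<in> E" "z \<notin> set (x # ys)" for z x ys
    using that by (auto simp: P_def)
  have "length xs \<le> card U" if "P xs" for xs
    using that fin by (metis P_def card_mono distinct_card)
  then have "\<exists>xs. P xs \<and> (\<forall>ys. P ys \<longrightarrow> length ys \<le> length xs)"
    by (intro ex_has_greatest_nat[of P "[s]" length "Suc (card U)"])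
      (use s(1) in \<open>auto simp: P_def less_Suc_eq_le\<close>)
  then obtain xs where xs: "P xs" and mx: "\<And>ys. P ys \<Longrightarrow> length ys \<le> length xs" by blast
  obtain t where t: "t \<in> U" "{s, t} \<in> E" using s(2) by auto
  have "t \<noteq> s" using t ac by (auto simp: acyclic_edges_def)
  then have "P [t, s]" using s(1) t by (auto simp: P_def insert_commute)
  from mx[OF this] have "2 \<le> length xs" by simp
  then obtain x v vs where xvs: "xs = x # v # vs" by (metis Suc_le_length_iff numeral_2_eq_2)
  \<comment> \<open>Such a path has the same, maximal length as \<open>xs\<close>: a further
    neighbor of \<open>y\<close> would either prolong it or be the end of a chord.\<close>
  have leaf: "nbrs E U y = {v}" if "P (y # v # vs)" for y
  proof -
    have "z = v" if z: "z \<in> U" "{y, z} \<in> E" for z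
    proof -
      have "z \<noteq> y" using z ac by (auto simp: acyclic_edges_def)
      have "z \<in> set (y # v # vs)"
        using Pext[OF \<open>P (y # v # vs)\<close> z(1)] z(2) mx[of "z # y # v # vs"] xvs
        by (auto simp: insert_commute)
      with \<open>z \<noteq> y\<close> have "z \<in> set (v # vs)" by simp
      then show ?thesis
        using no_chord[OF ac, of y "v # vs" z] that \<open>P (y # v # vs)\<close> z by (auto simp: P_def)
    qed
    then have "nbrs E U y \<subseteq> {v}" unfolding nbrs_def by blast
    moreover have "v \<in> nbrs E U y" using that by (auto simp: P_def)
    ultimately show ?thesis by blast
  qed
  have Pv: "P (v # vs)" using xs xvs by (auto simp: P_def)
  have off: "nbrs E U y = {v}" if "y \<in> nbrs E U v" "y \<notin> set (v # vs)" for y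
    by (rule leaf, rule Pext) (use Pv that in \<open>auto simp: insert_commute\<close>)
  show ?thesis
  proof (cases vs)
    \<comment> \<open>The longest path is a single edge, so the penultimate vertex is the root and
      the component is a star around \<open>s\<close>.\<close>
    case Nil
    then have "v = s" using Pv by (auto simp: P_def)
    have "nbrs E U y = {s}" if y: "y \<in> nbrs E U s" for y
    proof -
      have "y \<noteq> s" using y ac by (auto simp: acyclic_edges_def)
      then show ?thesis using off[of y] y \<open>v = s\<close> Nil by auto
    qed
    then show ?thesis by blast
  next
    case (Cons p ps)
    have vU: "v \<in> U" and p: "p \<in> nbrs E U v" and dv: "distinct (x # v # vs)"
      using xs xvs Cons by (auto simp: P_def)
    have "s = last vs" using xs xvs Cons by (simp add: P_def)
    then have "s \<in> set vs" using Cons by (metis last_in_set list.distinct(1))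
    then have vs: "v \<noteq> s" using dv by auto
    have "x \<in> nbrs E U v" using xs xvs by (auto simp: P_def insert_commute)
    moreover have "x \<noteq> p" using dv Cons by auto
    ultimately have "nbrs E U v \<noteq> {p}" by blast
    moreover have "nbrs E U y = {v}" if y: "y \<in> nbrs E U v - {p}" for y
    proof (rule off)
      show "y \<in> nbrs E U v" using y by simp
      have "y \<noteq> v" using y ac by (auto simp: acyclic_edges_def)
      moreover have "y \<notin> set vs"
        using no_chord[OF ac, of v vs y] Pv y Cons by (auto simp: P_def)
      ultimately show "y \<notin> set (v # vs)" by simp
    qed
    ultimately show ?thesis using vU vs p by blast
  qed
qed

text \<open>\<open>p\<close> is the only possible neighbor of \<open>v\<close> outside the leaves
  \<open>R\<close>, but need not be adjacent to \<open>v\<close>: when the component is a star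
  around \<open>s\<close>, the default \<open>p = s\<close> serves, since without loops
  \<open>s\<close> is not among its own leaves.\<close>

lemma pendant_star_exists:
  assumes ac: "acyclic_edges E" and fin: "finite U" and s: "s \<in> U" "nbrs E U s \<noteq> {}"
  obtains v R p where "v \<in> U" "R \<noteq> {}" "v \<notin> R" "R \<subseteq> nbrs E U v" "nbrs E U v \<subseteq> insert p R"
    "p \<notin> R" "\<And>x. x \<in> R \<Longrightarrow> nbrs E U x = {v}"
proof -
  have loop: "x \<notin> nbrs E U x" for x using ac by (auto simp: acyclic_edges_def)
  consider "\<forall>x\<in>nbrs E U s. nbrs E U x = {s}"
    | v p where "v \<in> U" "p \<in> nbrs E U v" "nbrs E U v \<noteq> {p}"
       "\<forall>x\<in>nbrs E U v - {p}. nbrs E U x = {v}"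
    using stem_exists[OF assms] by blast
  then show thesis
  proof cases
    case 1
    then show thesis using that[of s "nbrs E U s" s] s loop[of s] by blast
  next
    case 2
    have "nbrs E U v - {p} \<noteq> {}" using 2 by blast
    then show thesis using that[of v "nbrs E U v - {p}" p] 2 loop[of v] by blast
  qed
qed


section \<open>Painter's strategies\<close>

lemma painter_holds_mono:
  assumes "painter_holds E U j" "finite U" "j \<le> k"
  shows "painter_holds E U k"
  using assms game_determined lister_forces_mono by (metis Suc_le_mono)

text \<open>Admits the empty mark, which the rule of the game forbids: a combined strategy must also
  answer when the mark misses the part on which the given strategy plays.\<close>

lemma painter_response:
  assumes "painter_holds E U k" "M \<subseteq> U"
  obtains I where "I \<subseteq> M" "independent E I" "card M \<le> k" "painter_holds E (U - I) (k - card M)"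
proof (cases "M = {}")
  case True
  then show thesis using that[of "{}"] assms(1) by (simp add: independent_def)
next
  case False
  with assms(2) have "card M \<le> k \<and> (\<exists>I\<subseteq>M. independent E I \<and> painter_holds E (U - I) (k - card M))"
    using assms(1) by (simp add: painter_holds.simps[of E U k])
  then show thesis using that by blast
qed

lemma independent_Un:
  assumes "independent E I" "independent E J" "\<And>x y. x \<in> I \<Longrightarrow> y \<in> J \<Longrightarrow> {x, y} \<notin> E"
  shows "independent E (I \<union> J)"
  using assms unfolding independent_def by (metis Un_iff insert_commute)

text \<open>Painter colors each vertex of \<open>R\<close> the first time it is marked, at one point
  each, next to the old answer on \<open>U\<close>.\<close>

lemma painter_holds_isolated:
  assumes "painter_holds E U k" "finite U" "finite R" "U \<inter> R = {}"
    and "\<And>x y. x \<in> R \<Longrightarrow> y \<in> U \<union> R \<Longrightarrow> {x, y} \<notin> E"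
  shows "painter_holds E (U \<union> R) (k + card R)"
  using assms
proof (induction "k + card R" arbitrary: U k R rule: less_induct)
  case less
  show ?case
  proof (rule painter_holds.intros)
    fix M assume M: "M \<subseteq> U \<union> R" "M \<noteq> {}"
    define Q where "Q = M \<inter> R"
    obtain I where I: "I \<subseteq> M \<inter> U" "independent E I" "card (M \<inter> U) \<le> k"
      "painter_holds E (U - I) (k - card (M \<inter> U))"
      using painter_response[OF less.prems(1), of "M \<inter> U"] by auto
    have QR: "Q \<subseteq> R" "finite Q" using less.prems by (auto simp: Q_def)
    have "M = M \<inter> U \<union> Q" using M by (auto simp: Q_def)
    then have cM: "card M = card (M \<inter> U) + card Q"
      using less.prems by (metis Q_def card_Un_disjoint finite_Int inf_assoc inf_bot_right inf_left_commute)
    have cQ: "card Q \<le> card R" "card (R - Q) = card R - card Q"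
      using QR less.prems by (auto simp: card_mono card_Diff_subset)
    have "card M > 0" using M less.prems by (meson card_gt_0_iff finite_UnI finite_subset)
    then have "painter_holds E ((U - I) \<union> (R - Q)) (k - card (M \<inter> U) + card (R - Q))"
      by (intro less.hyps) (use I cQ cM less.prems in auto)
    moreover have "(U - I) \<union> (R - Q) = U \<union> R - (I \<union> Q)"
      using I QR less.prems(4) by (auto simp: Q_def)
    moreover have "k - card (M \<inter> U) + card (R - Q) = k + card R - card M"
      using cM cQ I by simp
    moreover have "independent E (I \<union> Q)"
    proof (rule independent_Un[OF I(2)])
      show "independent E Q" using less.prems(5) QR by (auto simp: independent_def)
      show "{x, y} \<notin> E" if "x \<in> I" "y \<in> Q" for x y
        using less.prems(5)[of y x] that I QR by (auto simp: insert_commute)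
    qed
    ultimately show "card M \<le> k + card R \<and> (\<exists>I\<subseteq>M. independent E I \<and>
        painter_holds E (U \<union> R - I) (k + card R - card M))"
      using cM cQ I(1,3) by (intro conjI exI[of _ "I \<union> Q"]) (auto simp: Q_def)
  qed
qed

text \<open>The condition on \<open>c\<close> says that \<open>card R\<close> is less than the triangular number of \<open>c + 1\<close>.
  If the answer of the strategy on \<open>U\<close> uses \<open>v\<close> but Painter would rather color the marked
  leaves, then Painter answers the mark without \<open>v\<close> instead, at the price of one point; at least
  \<open>c + 1\<close> marked leaves lower the admissible \<open>c\<close> by one, which pays for it.\<close>

lemma painter_holds_pendant_leaves:
  assumes "painter_holds E U k" "finite U" "finite R" "U \<inter> R = {}" "v \<notin> R"
    and "\<And>x y. x \<in> R \<Longrightarrow> y \<in> U \<union> R \<Longrightarrow> y \<noteq> v \<Longrightarrow> {x, y} \<notin> E"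
    and "2 * card R < (c + 1) * (c + 2)"
  shows "painter_holds E (U \<union> R) (k + card R + c)"
  using assms
proof (induction "k + card R" arbitrary: U k R c rule: less_induct)
  case less
  show ?case
  proof (rule painter_holds.intros)
    fix M assume M: "M \<subseteq> U \<union> R" "M \<noteq> {}"
    define Q where "Q = M \<inter> R"
    define m where "m = card (M \<inter> U)"
    have QR: "Q \<subseteq> R" "finite Q" using less.prems by (auto simp: Q_def)
    have "M = M \<inter> U \<union> Q" using M by (auto simp: Q_def)
    then have cM: "card M = m + card Q"
      using less.prems unfolding m_def
      by (metis Q_def card_Un_disjoint finite_Int inf_assoc inf_bot_right inf_left_commute)
    have cQ: "card Q \<le> card R" "card (R - Q) = card R - card Q"
      using QR less.prems by (auto simp: card_mono card_Diff_subset)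
    have cpos: "card M > 0" using M less.prems by (meson card_gt_0_iff finite_UnI finite_subset)
    have indQ: "independent E (I \<union> Q)" if "independent E I" "I \<subseteq> U" "v \<notin> I" for I
    proof (rule independent_Un[OF that(1)])
      show "independent E Q" using less.prems(5,6) QR by (fastforce simp: independent_def)
      show "{x, y} \<notin> E" if "x \<in> I" "y \<in> Q" for x y
        using less.prems(6)[of y x] that \<open>I \<subseteq> U\<close> \<open>v \<notin> I\<close> QR by (auto simp: insert_commute)
    qed
    have setQ: "(U - I) \<union> (R - Q) = U \<union> R - (I \<union> Q)" if "I \<subseteq> U" for I
      using that QR less.prems(4) by (auto simp: Q_def)
    obtain I where I: "I \<subseteq> M \<inter> U" "independent E I" "m \<le> k" "painter_holds E (U - I) (k - m)"
      using painter_response[OF less.prems(1), of "M \<inter> U"] unfolding m_def by auto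
    have cMk: "card M \<le> k + card R + c" using cM I(3) cQ by linarith
    have "\<exists>I\<subseteq>M. independent E I \<and> painter_holds E (U \<union> R - I) (k + card R + c - card M)"
    proof (cases "v \<in> I")
      case False
      have lt: "2 * card (R - Q) < (c + 1) * (c + 2)" using less.prems(7) cQ by linarith
      have "painter_holds E ((U - I) \<union> (R - Q)) (k - m + card (R - Q) + c)"
        by (intro less.hyps) (use I cQ cM cpos lt less.prems in auto)
      moreover have "k - m + card (R - Q) + c = k + card R + c - card M"
        using cM cQ I by simp
      ultimately show ?thesis
        using indQ[OF I(2) _ False] setQ[of I] I(1)
        by (intro exI[of _ "I \<union> Q"]) (auto simp: Q_def)
    next
      case True
      then have vM: "v \<in> M \<inter> U" using I by auto
      then have mpos: "0 < m" using less.prems unfolding m_def by (auto simp: card_gt_0_iff)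
      show ?thesis
      proof (cases "card Q \<le> c")
        \<comment> \<open>Painter gives only the old answer \<open>I\<close>. As it contains
          \<open>v\<close>, all leaves become isolated, and at most \<open>c\<close> marks, those on
          \<open>Q\<close>, are wasted.\<close>
        case le: True
        have RE: "{x, y} \<notin> E" if "x \<in> R" "y \<in> (U - I) \<union> R" for x y
          using less.prems(5,6) that True by blast
        have "painter_holds E ((U - I) \<union> R) (k - m + card R)"
          by (rule painter_holds_isolated[OF I(4)]) (use less.prems RE in auto)
        moreover have "(U - I) \<union> R = U \<union> R - I" using I less.prems(4) by blast
        ultimately have "painter_holds E (U \<union> R - I) (k + card R + c - card M)"
          using painter_holds_mono[of E "U \<union> R - I" "k - m + card R"] less.prems le cM I(3) by auto
        then show ?thesis using I by blast
      next
        case gt: False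
        have m1: "card (M \<inter> U - {v}) = m - 1"
          using vM less.prems unfolding m_def by simp
        obtain J where J: "J \<subseteq> M \<inter> U - {v}" "independent E J"
          "painter_holds E (U - J) (k - (m - 1))"
          using painter_response[OF less.prems(1), of "M \<inter> U - {v}"] m1 by auto
        have JU: "J \<subseteq> U" "v \<notin> J" using J(1) by auto
        obtain c' where c': "c = Suc c'"
          using gt less.prems(7) cQ by (cases c) auto
        \<comment> \<open>The left side has dropped by at least \<open>2 * (c + 1)\<close>, the
          difference between \<open>(c + 1) * (c + 2)\<close> and
          \<open>c * (c + 1)\<close>.\<close>
        have lt: "2 * card (R - Q) < (c' + 1) * (c' + 2)"
          using less.prems(7) cQ gt unfolding c' by simp
        have "painter_holds E ((U - J) \<union> (R - Q)) (k - (m - 1) + card (R - Q) + c')"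
          by (intro less.hyps) (use J cQ cM mpos gt c' lt I(3) less.prems in auto)
        moreover have "k - (m - 1) + card (R - Q) + c' = k + card R + c - card M"
          using cM cQ I mpos c' by simp
        ultimately show ?thesis
          using indQ[OF J(2) JU] setQ[OF JU(1)] J(1)
          by (intro exI[of _ "J \<union> Q"]) (auto simp: Q_def)
      qed
    qed
    then show "card M \<le> k + card R + c \<and> (\<exists>I\<subseteq>M. independent E I \<and>
        painter_holds E (U \<union> R - I) (k + card R + c - card M))"
      using cMk by blast
  qed
qed

text \<open>The extra difficulty is a conflict at the edge \<open>vp\<close>. If the answer on \<open>U\<close> uses \<open>p\<close> and at least
  \<open>c\<close> leaves are marked, then Painter follows it, which cuts off the star; with fewer marked leaves,
  coloring \<open>v\<close> leaves a point to spare, which pays for answering the mark without \<open>p\<close>.\<close>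

lemma painter_holds_pendant_star:
  assumes "painter_holds E U k" "finite U" "finite R" "U \<inter> R = {}" "v \<notin> U" "v \<notin> R"
    and "\<And>x y. x \<in> R \<Longrightarrow> y \<in> U \<union> R \<Longrightarrow> {x, y} \<notin> E"
    and "\<And>y. y \<in> U \<Longrightarrow> y \<noteq> p \<Longrightarrow> {v, y} \<notin> E" and "{v} \<notin> E"
    and "2 * (card R + 1) < (c + 1) * (c + 2)"
  shows "painter_holds E (insert v (U \<union> R)) (k + card R + 1 + c)"
  using assms
proof (induction "k + card R" arbitrary: U k R c rule: less_induct)
  case less
  show ?case
  proof (rule painter_holds.intros)
    fix M assume M: "M \<subseteq> insert v (U \<union> R)" "M \<noteq> {}"
    define Q where "Q = M \<inter> R"
    define m where "m = card (M \<inter> U)"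
    let ?d = "if v \<in> M then 1 else (0::nat)"
    have QR: "Q \<subseteq> R" "finite Q" using less.prems(3) by (auto simp: Q_def)
    define W where "W = M \<inter> U \<union> Q"
    have cW: "card W = m + card Q"
      using less.prems(2-4) unfolding m_def W_def
      by (metis Q_def card_Un_disjoint finite_Int inf_assoc inf_bot_right inf_left_commute)
    have W: "v \<notin> W" "finite W" using less.prems(2,5,6) QR by (auto simp: W_def)
    have cM: "card M = m + card Q + ?d"
    proof (cases "v \<in> M")
      case True
      then have "M = insert v W" using M by (auto simp: Q_def W_def)
      with W cW True show ?thesis by simp
    next
      case False
      then have "M = W" using M by (auto simp: Q_def W_def)
      with cW False show ?thesis by simp
    qed
    have cQ: "card Q \<le> card R" "card (R - Q) = card R - card Q"
      using QR less.prems(3) by (auto simp: card_mono card_Diff_subset)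
    have "finite M" using M less.prems(2,3) by (meson finite_UnI finite_insert finite_subset)
    then have cpos: "card M > 0" using M by (simp add: card_gt_0_iff)
    have indQ: "independent E (I \<union> Q)" if "independent E I" "I \<subseteq> U" for I
    proof (rule independent_Un[OF that(1)])
      show "independent E Q" using less.prems(7) QR by (fastforce simp: independent_def)
      show "{x, y} \<notin> E" if "x \<in> I" "y \<in> Q" for x y
        using less.prems(7)[of y x] that \<open>I \<subseteq> U\<close> QR by (auto simp: insert_commute)
    qed
    have indv: "independent E (I \<union> {v})" if "independent E I" "I \<subseteq> U" "p \<notin> I" for I
    proof (rule independent_Un[OF that(1)])
      show "independent E {v}" using less.prems(9) by (simp add: independent_def)
      show "{x, y} \<notin> E" if "x \<in> I" "y \<in> {v}" for x y
        using less.prems(8)[of x] that \<open>I \<subseteq> U\<close> \<open>p \<notin> I\<close> by (auto simp: insert_commute)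
    qed
    have setQ: "insert v ((U - I) \<union> (R - Q)) = insert v (U \<union> R) - (I \<union> Q)" if "I \<subseteq> U" for I
      using that QR less.prems(4-6) by (auto simp: Q_def)
    have setv: "(U - I) \<union> R = insert v (U \<union> R) - (I \<union> {v})" if "I \<subseteq> U" for I
      using that QR less.prems(4-6) by auto
    obtain I where I: "I \<subseteq> M \<inter> U" "independent E I" "m \<le> k" "painter_holds E (U - I) (k - m)"
      using painter_response[OF less.prems(1), of "M \<inter> U"] unfolding m_def by auto
    have IU: "I \<subseteq> U" using I(1) by blast
    have cpos': "0 < c" using less.prems(10) by (cases c) auto
    have cMk: "card M \<le> k + card R + 1 + c" using cM I(3) cQ by auto
    \<comment> \<open>Coloring \<open>v\<close> isolates its leaves, so the marks on
      \<open>Q\<close> are wasted; \<open>j\<close> is what the strategy still allows on the rest of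
      \<open>U\<close>.\<close>
    have color_v: "\<exists>I\<subseteq>M. independent E I \<and>
        painter_holds E (insert v (U \<union> R) - I) (k + card R + 1 + c - card M)"
      if "J \<subseteq> M \<inter> U" "independent E J" "p \<notin> J" "v \<in> M"
        "painter_holds E (U - J) j" "j + card R \<le> k + card R + 1 + c - card M" for J j
    proof -
      have "painter_holds E ((U - J) \<union> R) (j + card R)"
        by (rule painter_holds_isolated[OF that(5)]) (use less.prems(2-7) in auto)
      then have "painter_holds E ((U - J) \<union> R) (k + card R + 1 + c - card M)"
        by (rule painter_holds_mono) (use less.prems(2,3) that in auto)
      then show ?thesis
        using indv[OF that(2) _ that(3)] setv[of J] that(1,4)
        by (intro exI[of _ "J \<union> {v}"]) auto
    qed
    \<comment> \<open>Rejecting \<open>v\<close> keeps the shape of the position, a star with fewer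
      leaves hung on the rest of \<open>U\<close>. Induction applies with \<open>c' = c\<close> or,
      if a mark on \<open>v\<close> has to be paid for, with \<open>c' = c - 1\<close>.\<close>
    have color_Q: "\<exists>I\<subseteq>M. independent E I \<and>
        painter_holds E (insert v (U \<union> R) - I) (k + card R + 1 + c - card M)"
      if "2 * (card (R - Q) + 1) < (c' + 1) * (c' + 2)"
        "k - m + card (R - Q) + 1 + c' = k + card R + 1 + c - card M" and Q0: "0 < m + card Q" for c'
    proof -
      have "painter_holds E (insert v ((U - I) \<union> (R - Q))) (k - m + card (R - Q) + 1 + c')"
      proof (rule less.hyps)
        have "card (M \<inter> U) + card Q > 0" using Q0 unfolding m_def by simp
        then show "k - m + card (R - Q) < k + card R" using cQ I(3) m_def by linarith
        show "painter_holds E (U - I) (k - m)" by (rule I(4))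
        show "{x, y} \<notin> E" if "x \<in> R - Q" "y \<in> U - I \<union> (R - Q)" for x y
          using that less.prems(7) by auto
        show "{v, y} \<notin> E" if "y \<in> U - I" "y \<noteq> p" for y
          using that less.prems(8) by auto
      qed (use that(1) less.prems(2-6,9) in auto)
      then show ?thesis
        using indQ[OF I(2) IU] setQ[OF IU] I(1) that(2)
        by (intro exI[of _ "I \<union> Q"]) (auto simp: Q_def)
    qed
    have "\<exists>I\<subseteq>M. independent E I \<and>
        painter_holds E (insert v (U \<union> R) - I) (k + card R + 1 + c - card M)"
    proof (cases "v \<in> M")
      case False
      show ?thesis
        by (rule color_Q[of c]) (use False cM cQ I(3) cpos less.prems(10) in auto)
    next
      case vM: True
      show ?thesis
      proof (cases "p \<in> I")
        case False
        show ?thesis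
        proof (cases "card Q \<le> c")
          case True
          show ?thesis
            by (rule color_v[OF I(1,2) False vM I(4)]) (use cM vM True I(3) in auto)
        next
          case gt: False
          obtain c' where c': "c = Suc c'" using cpos' by (cases c) auto
          show ?thesis
            by (rule color_Q[of c']) (use vM cM cQ I(3) c' gt less.prems(10) in auto)
        qed
      next
        case pI: True
        show ?thesis
        proof (cases "c \<le> card Q")
          case False
          have pM: "p \<in> M \<inter> U" using pI I by auto
          then have mpos: "0 < m" using less.prems(2) pM unfolding m_def by (auto simp: card_gt_0_iff)
          have m1: "card (M \<inter> U - {p}) = m - 1"
            using pM less.prems(2) unfolding m_def by simp
          obtain J where J: "J \<subseteq> M \<inter> U - {p}" "independent E J"
            "painter_holds E (U - J) (k - (m - 1))"
            using painter_response[OF less.prems(1), of "M \<inter> U - {p}"] m1 by auto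
          show ?thesis
            by (rule color_v[OF _ J(2) _ vM J(3)]) (use J cM vM False I(3) mpos in auto)
        next
          \<comment> \<open>With \<open>p\<close> colored, \<open>v\<close> counts as an isolated
            vertex with the remaining leaves pendant at it. Only \<open>c\<close> marked leaves are
            guaranteed here instead of \<open>c + 1\<close>; the \<open>+ 1\<close> next to
            \<open>card R\<close> in the hypothesis is exactly what this costs.\<close>
          case True
          obtain c' where c': "c = Suc c'" using cpos' by (cases c) auto
          have lt: "2 * card (R - Q) < (c' + 1) * (c' + 2)"
            using less.prems(10) cQ True unfolding c' by simp
          have vE: "{v, y} \<notin> E" if "y \<in> (U - I) \<union> {v}" for y
            using that less.prems(8)[of y] less.prems(9) pI by auto
          have "painter_holds E ((U - I) \<union> {v}) (k - m + card {v})"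
            by (rule painter_holds_isolated[OF I(4)]) (use less.prems(2,5) vE in auto)
          then have "painter_holds E ((U - I) \<union> {v} \<union> (R - Q)) (k - m + card {v} + card (R - Q) + c')"
          proof (rule painter_holds_pendant_leaves[where v = v])
            show "{x, y} \<notin> E" if "x \<in> R - Q" "y \<in> U - I \<union> {v} \<union> (R - Q)" "y \<noteq> v" for x y
              using that less.prems(7) by auto
          qed (use less.prems(2-6) lt in auto)
          moreover have "(U - I) \<union> {v} \<union> (R - Q) = insert v (U \<union> R) - (I \<union> Q)"
            using setQ[OF IU] by auto
          moreover have "k - m + card {v} + card (R - Q) + c' = k + card R + 1 + c - card M"
            using cM cQ vM I(3) c' by simp
          ultimately show ?thesis
            using indQ[OF I(2) IU] I(1)
            by (intro exI[of _ "I \<union> Q"]) (auto simp: Q_def)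
        qed
      qed
    qed
    then show "card M \<le> k + card R + 1 + c \<and> (\<exists>I\<subseteq>M. independent E I \<and>
        painter_holds E (insert v (U \<union> R) - I) (k + card R + 1 + c - card M))"
      using cMk by blast
  qed
qed

section \<open>Spanning forests with degrees 1 and 3, extended over stars\<close>

definition odd_factor :: "'a set set \<Rightarrow> 'a set \<Rightarrow> bool" where
  "odd_factor E U \<longleftrightarrow> (\<exists>F\<subseteq>E. F \<subseteq> Pow U \<and> (\<forall>w\<in>U. card (nbrs F U w) \<in> {1, 3}))"

text \<open>For acyclic \<open>E\<close> this is the spanning forest wanted for odd order, as
  \<open>odd_factor\<close> is for even order; acyclicity is inherited from \<open>E\<close>, and
  \<open>F \<subseteq> Pow U\<close> makes the degrees within \<open>U\<close> the true
  degrees.\<close>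

definition near_odd_factor :: "'a set set \<Rightarrow> 'a set \<Rightarrow> bool" where
  "near_odd_factor E U \<longleftrightarrow> (\<exists>F\<subseteq>E. F \<subseteq> Pow U \<and> (\<exists>s\<in>U. card (nbrs F U s) \<in> {0, 6} \<and>
     (\<forall>w\<in>U - {s}. card (nbrs F U w) \<in> {1, 3})))"

lemma odd_factorI:
  "F \<subseteq> E \<Longrightarrow> F \<subseteq> Pow U \<Longrightarrow> (\<And>w. w \<in> U \<Longrightarrow> card (nbrs F U w) \<in> {1, 3}) \<Longrightarrow> odd_factor E U"
  unfolding odd_factor_def by blast

lemma near_odd_factorI:
  "F \<subseteq> E \<Longrightarrow> F \<subseteq> Pow U \<Longrightarrow> s \<in> U \<Longrightarrow> card (nbrs F U s) \<in> {0, 6} \<Longrightarrow>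
   (\<And>w. w \<in> U \<Longrightarrow> w \<noteq> s \<Longrightarrow> card (nbrs F U w) \<in> {1, 3}) \<Longrightarrow> near_odd_factor E U"
  unfolding near_odd_factor_def by (intro exI[of _ F] conjI bexI[of _ s] ballI) simp_all

text \<open>Serves two situations: \<open>v\<close> is new when a whole star was deleted, and in
  \<open>H\<close> when only its leaves were. A proper subset \<open>S\<close> of \<open>R\<close>
  leaves a leaf isolated, to act as the exceptional vertex.\<close>

lemma card_nbrs_add_star:
  assumes "F \<subseteq> Pow H" "R \<inter> H = {}" "v \<notin> R" "S \<subseteq> R" "finite H" "finite R"
  defines "F' \<equiv> F \<union> (\<lambda>x. {v, x}) ` S" and "U \<equiv> insert v (H \<union> R)"
  shows "w \<in> H \<Longrightarrow> w \<noteq> v \<Longrightarrow> card (nbrs F' U w) = card (nbrs F H w)"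
    and "x \<in> S \<Longrightarrow> card (nbrs F' U x) = 1"
    and "x \<in> R \<Longrightarrow> x \<notin> S \<Longrightarrow> card (nbrs F' U x) = 0"
    and "card (nbrs F' U v) = card (nbrs F H v) + card S"
    and "F' \<subseteq> Pow U"
proof -
  have FH: "a \<in> H \<and> b \<in> H" if "{a, b} \<in> F" for a b using that assms(1) by auto
  have star: "{a, b} \<in> (\<lambda>x. {v, x}) ` S \<longleftrightarrow> a = v \<and> b \<in> S \<or> b = v \<and> a \<in> S" for a b
    by (auto simp: doubleton_eq_iff)
  have F': "{a, b} \<in> F' \<longleftrightarrow> {a, b} \<in> F \<or> a = v \<and> b \<in> S \<or> b = v \<and> a \<in> S" for a b
    unfolding F'_def using star by blast
  have "nbrs F' U w = nbrs F H w" if "w \<in> H" "w \<noteq> v"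
    unfolding nbrs_def F' U_def using that FH assms(2,4) by blast
  then show "w \<in> H \<Longrightarrow> w \<noteq> v \<Longrightarrow> card (nbrs F' U w) = card (nbrs F H w)" by simp
  have "nbrs F' U x = {v}" if "x \<in> S"
    unfolding nbrs_def F' U_def using that FH assms(2-4) by blast
  then show "x \<in> S \<Longrightarrow> card (nbrs F' U x) = 1" by simp
  have "nbrs F' U x = {}" if "x \<in> R" "x \<notin> S"
    unfolding nbrs_def F' U_def using that FH assms(2-4) by blast
  then show "x \<in> R \<Longrightarrow> x \<notin> S \<Longrightarrow> card (nbrs F' U x) = 0" by simp
  have "nbrs F' U v = nbrs F H v \<union> S"
    unfolding nbrs_def F' U_def using FH assms(2-4) by blast
  moreover have "nbrs F H v \<inter> S = {}" using assms(2,4) by auto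
  ultimately show "card (nbrs F' U v) = card (nbrs F H v) + card S"
    using assms(4-6) by (simp add: card_Un_disjoint finite_subset)
  show "F' \<subseteq> Pow U" using assms(1,4) unfolding F'_def U_def by auto
qed

lemma card_nbrs_outside: "F \<subseteq> Pow H \<Longrightarrow> v \<notin> H \<Longrightarrow> card (nbrs F H v) = 0"
  by (auto simp: nbrs_def card_eq_0_iff)

lemma star_subset:
  assumes "F \<subseteq> E" "\<And>x. x \<in> R \<Longrightarrow> {v, x} \<in> E" "S \<subseteq> R"
  shows "F \<union> (\<lambda>x. {v, x}) ` S \<subseteq> E"
  using assms by blast

context
  fixes E :: "'a set set" and H R :: "'a set" and v :: 'a
  assumes disj: "R \<inter> H = {}" and vR: "v \<notin> R" and finH: "finite H" and finR: "finite R"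
    and star: "\<And>x. x \<in> R \<Longrightarrow> {v, x} \<in> E"
begin

lemma odd_factor_add_star:
  assumes "odd_factor E H" "v \<notin> H" "card R \<in> {1, 3}"
  shows "odd_factor E (insert v (H \<union> R))"
proof -
  from assms(1) obtain F where F: "F \<subseteq> E" "F \<subseteq> Pow H" "\<forall>w\<in>H. card (nbrs F H w) \<in> {1, 3}"
    unfolding odd_factor_def by blast
  note d = card_nbrs_add_star[OF F(2) disj vR subset_refl finH finR]
  show ?thesis
  proof (rule odd_factorI[OF star_subset[OF F(1) star subset_refl] d(5)])
    show "card (nbrs (F \<union> (\<lambda>x. {v, x}) ` R) (insert v (H \<union> R)) w) \<in> {1, 3}"
      if "w \<in> insert v (H \<union> R)" for w
      using that d(1,2)[of w] d(4) F(3) assms(2,3) card_nbrs_outside[OF F(2) assms(2)]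
      by (cases "w = v") auto
  qed
qed

lemma near_odd_factor_add_star:
  assumes "near_odd_factor E H" "v \<notin> H" "card R \<in> {1, 3}"
  shows "near_odd_factor E (insert v (H \<union> R))"
proof -
  from assms(1) obtain F s where F: "F \<subseteq> E" "F \<subseteq> Pow H" and s: "s \<in> H"
    "card (nbrs F H s) \<in> {0, 6}" "\<forall>w\<in>H - {s}. card (nbrs F H w) \<in> {1, 3}"
    unfolding near_odd_factor_def by blast
  note d = card_nbrs_add_star[OF F(2) disj vR subset_refl finH finR]
  have "s \<noteq> v" using s assms(2) by blast
  show ?thesis
  proof (rule near_odd_factorI[OF star_subset[OF F(1) star subset_refl] d(5), of s])
    show "card (nbrs (F \<union> (\<lambda>x. {v, x}) ` R) (insert v (H \<union> R)) w) \<in> {1, 3}"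
      if "w \<in> insert v (H \<union> R)" "w \<noteq> s" for w
      using that d(1,2)[of w] d(4) s(3) assms(2,3) card_nbrs_outside[OF F(2) assms(2)]
      by (cases "w = v") auto
  qed (use d(1)[of s] s \<open>s \<noteq> v\<close> in auto)
qed

text \<open>Four edges at \<open>v\<close> would give a forbidden degree; one leaf stays isolated
  and becomes the exceptional vertex.\<close>

lemma near_odd_factor_add_star4:
  assumes "odd_factor E H" "v \<notin> H" "card R = 4"
  shows "near_odd_factor E (insert v (H \<union> R))"
proof -
  from assms(1) obtain F where F: "F \<subseteq> E" "F \<subseteq> Pow H" "\<forall>w\<in>H. card (nbrs F H w) \<in> {1, 3}"
    unfolding odd_factor_def by blast
  obtain s where s: "s \<in> R" using assms(3) by (metis card.empty equals0I zero_neq_numeral)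
  have S: "R - {s} \<subseteq> R" "card (R - {s}) = 3" using s assms(3) by auto
  note d = card_nbrs_add_star[OF F(2) disj vR S(1) finH finR]
  show ?thesis
  proof (rule near_odd_factorI[OF star_subset[OF F(1) star S(1)] d(5), of s])
    show "card (nbrs (F \<union> (\<lambda>x. {v, x}) ` (R - {s})) (insert v (H \<union> R)) w) \<in> {1, 3}"
      if "w \<in> insert v (H \<union> R)" "w \<noteq> s" for w
      using that d(1,2)[of w] d(4) F(3) S assms(2) card_nbrs_outside[OF F(2) assms(2)]
      by (cases "w = v") auto
  qed (use d(3)[of s] s in auto)
qed

text \<open>The center \<open>v\<close> becomes the exceptional vertex, of degree 6.\<close>

lemma near_odd_factor_add_star6:
  assumes "odd_factor E H" "v \<notin> H" "card R = 6"
  shows "near_odd_factor E (insert v (H \<union> R))"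
proof -
  from assms(1) obtain F where F: "F \<subseteq> E" "F \<subseteq> Pow H" "\<forall>w\<in>H. card (nbrs F H w) \<in> {1, 3}"
    unfolding odd_factor_def by blast
  note d = card_nbrs_add_star[OF F(2) disj vR subset_refl finH finR]
  show ?thesis
  proof (rule near_odd_factorI[OF star_subset[OF F(1) star subset_refl] d(5), of v])
    show "card (nbrs (F \<union> (\<lambda>x. {v, x}) ` R) (insert v (H \<union> R)) w) \<in> {1, 3}"
      if "w \<in> insert v (H \<union> R)" "w \<noteq> v" for w
      using that d(1,2)[of w] F(3) by auto
  qed (use d(4) assms(3) card_nbrs_outside[OF F(2) assms(2)] in auto)
qed

text \<open>Having at most one neighbor in \<open>H\<close>, the vertex \<open>v\<close> has degree
  1 in the old factor, and five new edges make it 6.\<close>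

lemma near_odd_factor_add_leaves5:
  assumes "odd_factor E H" "v \<in> H" "nbrs E H v \<subseteq> {p}" "card R = 5"
  shows "near_odd_factor E (insert v (H \<union> R))"
proof -
  from assms(1) obtain F where F: "F \<subseteq> E" "F \<subseteq> Pow H" "\<forall>w\<in>H. card (nbrs F H w) \<in> {1, 3}"
    unfolding odd_factor_def by blast
  have "nbrs F H v \<subseteq> {p}" using F(1) assms(3) unfolding nbrs_def by blast
  then have "card (nbrs F H v) \<le> 1" using card_mono[of "{p}"] by fastforce
  then have one: "card (nbrs F H v) = 1" using F(3) assms(2) by fastforce
  note d = card_nbrs_add_star[OF F(2) disj vR subset_refl finH finR]
  show ?thesis
  proof (rule near_odd_factorI[OF star_subset[OF F(1) star subset_refl] d(5), of v])
    show "card (nbrs (F \<union> (\<lambda>x. {v, x}) ` R) (insert v (H \<union> R)) w) \<in> {1, 3}"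
      if "w \<in> insert v (H \<union> R)" "w \<noteq> v" for w
      using that d(1,2)[of w] F(3) by auto
  qed (use d(4) assms(4) one in auto)
qed

lemma odd_factor_add_leaves2:
  assumes "odd_factor E H" "v \<in> H" "nbrs E H v \<subseteq> {p}" "card R = 2"
  shows "odd_factor E (insert v (H \<union> R))"
proof -
  from assms(1) obtain F where F: "F \<subseteq> E" "F \<subseteq> Pow H" "\<forall>w\<in>H. card (nbrs F H w) \<in> {1, 3}"
    unfolding odd_factor_def by blast
  have "nbrs F H v \<subseteq> {p}" using F(1) assms(3) unfolding nbrs_def by blast
  then have "card (nbrs F H v) \<le> 1" using card_mono[of "{p}"] by fastforce
  then have one: "card (nbrs F H v) = 1" using F(3) assms(2) by fastforce
  note d = card_nbrs_add_star[OF F(2) disj vR subset_refl finH finR]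
  have "card (nbrs (F \<union> (\<lambda>x. {v, x}) ` R) (insert v (H \<union> R)) w) \<in> {1, 3}"
    if "w \<in> insert v (H \<union> R)" for w
    using that d(1,2)[of w] d(4) F(3) assms(4) one by (cases "w = v") auto
  then show ?thesis
    by (intro odd_factorI[OF star_subset[OF F(1) star subset_refl] d(5)])
qed

text \<open>If \<open>v\<close> is the exceptional vertex, then its degree is 0, as it has at most
  one neighbor in \<open>H\<close>; one new edge repairs it and the other leaf takes over its role.
  Otherwise the degree of \<open>v\<close> grows from 1 to 3.\<close>

lemma near_odd_factor_add_leaves2:
  assumes "near_odd_factor E H" "v \<in> H" "nbrs E H v \<subseteq> {p}" "card R = 2"
  shows "near_odd_factor E (insert v (H \<union> R))"
proof -
  from assms(1) obtain F s where F: "F \<subseteq> E" "F \<subseteq> Pow H" and s: "s \<in> H"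
    "card (nbrs F H s) \<in> {0, 6}" "\<forall>w\<in>H - {s}. card (nbrs F H w) \<in> {1, 3}"
    unfolding near_odd_factor_def by blast
  have "nbrs F H v \<subseteq> {p}" using F(1) assms(3) unfolding nbrs_def by blast
  then have le: "card (nbrs F H v) \<le> 1" using card_mono[of "{p}"] by fastforce
  show ?thesis
  proof (cases "s = v")
    case True
    then have zero: "card (nbrs F H v) = 0" using le s(2) by auto
    obtain t where t: "t \<in> R" using assms(4) by (metis card.empty equals0I zero_neq_numeral)
    have S: "R - {t} \<subseteq> R" "card (R - {t}) = 1" using t assms(4) by auto
    let ?F = "F \<union> (\<lambda>x. {v, x}) ` (R - {t})"
    note d = card_nbrs_add_star[OF F(2) disj vR S(1) finH finR]
    have "card (nbrs ?F (insert v (H \<union> R)) w) \<in> {1, 3}"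
      if "w \<in> insert v (H \<union> R) - {t}" for w
      using that d(1,2)[of w] d(4) s(3) S(2) zero True by (cases "w = v") auto
    then show ?thesis
      by (intro near_odd_factorI[OF star_subset[OF F(1) star S(1)] d(5), of t])
        (use d(3)[of t] t in auto)
  next
    case False
    then have one: "card (nbrs F H v) = 1" using s(3) assms(2) le by fastforce
    let ?F = "F \<union> (\<lambda>x. {v, x}) ` R"
    note d = card_nbrs_add_star[OF F(2) disj vR subset_refl finH finR]
    have "card (nbrs ?F (insert v (H \<union> R)) w) \<in> {1, 3}"
      if "w \<in> insert v (H \<union> R) - {s}" for w
      using that d(1,2)[of w] d(4) s(3) assms(4) one by (cases "w = v") auto
    then show ?thesis
      by (intro near_odd_factorI[OF star_subset[OF F(1) star subset_refl] d(5), of s])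
        (use d(1)[of s] s False in auto)
  qed
qed

end

section \<open>The upper bound and the case of equality\<close>

lemma painter_holds_forest:
  assumes "acyclic_edges E" "finite U"
  shows "\<exists>k. painter_holds E U k \<and> (k < 3 * card U div 2 \<or> k = 3 * card U div 2 \<and>
    (if even (card U) then odd_factor E U else near_odd_factor E U))"
  using assms(2)
proof (induction "card U" arbitrary: U rule: less_induct)
  case less
  define bound where "bound W k \<longleftrightarrow> k < 3 * card W div 2 \<or> k = 3 * card W div 2 \<and>
    (if even (card W) then odd_factor E W else near_odd_factor E W)" for W k
  have step_even: "bound W (k + 3 * d)"
    if "bound W' k" "card W = card W' + 2 * d" "odd_factor E W' \<Longrightarrow> odd_factor E W"
      "near_odd_factor E W' \<Longrightarrow> near_odd_factor E W" for W W' k d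
  proof -
    have "3 * card W div 2 = 3 * card W' div 2 + 3 * d" using that(2) by linarith
    moreover have "even (card W) = even (card W')" using that(2) by simp
    ultimately show ?thesis using that(1,3,4) by (auto simp: bound_def split: if_splits)
  qed
  \<comment> \<open>Here \<open>2 * d + 1\<close> vertices cost half a point less than 3/2 each.
    Starting from an odd order, the two floors turn this into a full point and the bound is strict;
    only from an even order does a factor have to be extended.\<close>
  have step_odd: "bound W (k + 3 * d + 1)"
    if "bound W' k" "card W = card W' + (2 * d + 1)" "odd_factor E W' \<Longrightarrow> near_odd_factor E W"
    for W W' k d
  proof (cases "even (card W')")
    case True
    then have "3 * card W div 2 = 3 * card W' div 2 + 3 * d + 1" using that(2) by presburger
    moreover have "odd (card W)" using that(2) True by simp
    ultimately show ?thesis using that(1,3) True by (auto simp: bound_def)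
  next
    case False
    then have "3 * card W' div 2 + 3 * d + 1 < 3 * card W div 2" using that(2) by presburger
    then show ?thesis using that(1) by (auto simp: bound_def)
  qed
  have loop: "{x} \<notin> E" for x using assms(1) by (simp add: acyclic_edges_def)
  have "\<exists>k. painter_holds E U k \<and> bound U k"
  proof (cases "\<exists>s\<in>U. nbrs E U s \<noteq> {}")
    case False
    have noE: "{x, y} \<notin> E" if "x \<in> U" "y \<in> U" for x y
      using False that unfolding nbrs_def by blast
    have "painter_holds E {} 0" by (rule painter_holds.intros) auto
    then have "painter_holds E ({} \<union> U) (0 + card U)"
      by (rule painter_holds_isolated) (use noE less.prems in auto)
    \<comment> \<open>Without edges the bound is attained only by at most one vertex, and a single
      vertex is already the exceptional one.\<close>
    moreover have "bound U (card U)"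
    proof -
      consider "card U = 0" | "card U = 1" | "2 \<le> card U" by linarith
      then show ?thesis
      proof cases
        case 1
        then have "U = {}" using less.prems by simp
        moreover have "odd_factor E {}" by (rule odd_factorI[of "{}"]) simp_all
        ultimately show ?thesis by (simp add: bound_def)
      next
        case 2
        then obtain s where "U = {s}" by (auto simp: card_1_singleton_iff)
        have "near_odd_factor E {s}"
          by (rule near_odd_factorI[of "{}" _ _ s]) (simp_all add: nbrs_def)
        then show ?thesis using \<open>U = {s}\<close> by (simp add: bound_def)
      next
        case 3
        then have "card U < 3 * card U div 2" by linarith
        then show ?thesis by (simp add: bound_def)
      qed
    qed
    ultimately show ?thesis by auto
  next
    case True
    then obtain s where s: "s \<in> U" "nbrs E U s \<noteq> {}" by blast
    obtain v R p where v: "v \<in> U" and R: "R \<noteq> {}" "v \<notin> R" "R \<subseteq> nbrs E U v"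
      "nbrs E U v \<subseteq> insert p R" "p \<notin> R" "\<And>x. x \<in> R \<Longrightarrow> nbrs E U x = {v}"
      by (rule pendant_star_exists[OF assms(1) less.prems s]) blast
    define r where "r = card R"
    have RU: "R \<subseteq> U" using R(3) by auto
    then have finR: "finite R" using less.prems finite_subset by blast
    have r0: "0 < r" using R(1) finR by (simp add: r_def card_gt_0_iff)
    have star: "{v, x} \<in> E" if "x \<in> R" for x using that R(3) by auto
    have leafE: "y = v" if "x \<in> R" "y \<in> U" "{x, y} \<in> E" for x y
      using R(6)[OF that(1)] that(2,3) unfolding nbrs_def by blast
    \<comment> \<open>Two deletions are prepared: \<open>H\<close> lacks the whole star,
      \<open>T\<close> only its leaves.\<close>
    define H where "H = U - insert v R"
    define T where "T = U - R"
    have U: "insert v (H \<union> R) = U" "insert v (T \<union> R) = U" "T \<union> R = U"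
      using v RU by (auto simp: H_def T_def)
    have cU: "card U = card T + r" "card T = card H + 1"
    proof -
      show "card U = card T + r"
        unfolding T_def r_def using RU less.prems finR
        by (simp add: card_Diff_subset card_mono)
      have "T = insert v H" "v \<notin> H" "finite H" using v R(2) less.prems by (auto simp: H_def T_def)
      then show "card T = card H + 1" by simp
    qed
    have fin: "finite H" "finite T" using less.prems by (auto simp: H_def T_def)
    have disj: "R \<inter> H = {}" "R \<inter> T = {}" by (auto simp: H_def T_def)
    have vH: "v \<notin> H" and vT: "v \<in> T" using v R(2) by (auto simp: H_def T_def)
    have Tp: "nbrs E T v \<subseteq> {p}" using R(4) by (auto simp: T_def)
    obtain kH where kH: "painter_holds E H kH" "bound H kH"
      using less.hyps[of H] cU fin unfolding bound_def by auto
    obtain kT where kT: "painter_holds E T kT" "bound T kT"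
      using less.hyps[of T] cU r0 fin unfolding bound_def by auto
    have via_H: "painter_holds E U (kH + r + 1 + c)" if "2 * (r + 1) < (c + 1) * (c + 2)" for c
    proof -
      have "painter_holds E (insert v (H \<union> R)) (kH + card R + 1 + c)"
      proof (rule painter_holds_pendant_star[OF kH(1), where p = p])
        show "{x, y} \<notin> E" if "x \<in> R" "y \<in> H \<union> R" for x y
          using leafE[of x y] that RU R(2) by (auto simp: H_def)
        show "{v, y} \<notin> E" if "y \<in> H" "y \<noteq> p" for y
          using R(4) that by (auto simp: H_def)
      qed (use fin finR disj vH R(2) loop that r_def in auto)
      then show ?thesis using U by (simp add: r_def)
    qed
    have via_T: "painter_holds E U (kT + r + c)" if "2 * r < (c + 1) * (c + 2)" for c
    proof -
      have "painter_holds E (T \<union> R) (kT + card R + c)"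
      proof (rule painter_holds_pendant_leaves[OF kT(1), where v = v])
        show "{x, y} \<notin> E" if "x \<in> R" "y \<in> T \<union> R" "y \<noteq> v" for x y
          using leafE[of x y] that RU by (auto simp: T_def)
      qed (use fin finR disj R(2) that r_def in auto)
      then show ?thesis using U by (simp add: r_def)
    qed
    \<comment> \<open>The least admissible \<open>c\<close> is 1, 2, 2, 3, 3 for the stars with
      \<open>r = 1, 3, 4, 6, 7\<close> and 1, 2 for the leaves with \<open>r = 2, 5\<close>. Each
      case takes the deletion that stays within 3/2 per vertex and, unless it saves a whole point,
      extends a factor.\<close>
    consider "r = 1" | "r = 2" | "r = 3" | "r = 4" | "r = 5" | "r = 6" | "r = 7" | "8 \<le> r"
      using r0 by linarith
    then show ?thesis
    proof cases
      case 1
      have "bound U (kH + 3 * 1)"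
      proof (rule step_even[OF kH(2)])
        show "odd_factor E U" if "odd_factor E H"
          using odd_factor_add_star[OF disj(1) R(2) fin(1) finR star that vH] 1 U by (simp add: r_def)
        show "near_odd_factor E U" if "near_odd_factor E H"
          using near_odd_factor_add_star[OF disj(1) R(2) fin(1) finR star that vH] 1 U by (simp add: r_def)
      qed (use cU 1 in simp)
      then show ?thesis using via_H[of 1] 1 by (auto simp: numeral_eq_Suc)
    next
      case 2
      have "bound U (kT + 3 * 1)"
      proof (rule step_even[OF kT(2)])
        show "odd_factor E U" if "odd_factor E T"
          using odd_factor_add_leaves2[OF disj(2) R(2) fin(2) finR star that vT Tp] 2 U by (simp add: r_def)
        show "near_odd_factor E U" if "near_odd_factor E T"
          using near_odd_factor_add_leaves2[OF disj(2) R(2) fin(2) finR star that vT Tp] 2 U by (simp add: r_def)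
      qed (use cU(1) 2 in simp)
      then show ?thesis using via_T[of 1] 2 by (auto simp: numeral_eq_Suc)
    next
      case 3
      have "bound U (kH + 3 * 2)"
      proof (rule step_even[OF kH(2)])
        show "odd_factor E U" if "odd_factor E H"
          using odd_factor_add_star[OF disj(1) R(2) fin(1) finR star that vH] 3 U by (simp add: r_def)
        show "near_odd_factor E U" if "near_odd_factor E H"
          using near_odd_factor_add_star[OF disj(1) R(2) fin(1) finR star that vH] 3 U by (simp add: r_def)
      qed (use cU 3 in simp)
      then show ?thesis using via_H[of 2] 3 by (auto simp: numeral_eq_Suc)
    next
      case 4
      have "bound U (kH + 3 * 2 + 1)"
      proof (rule step_odd[OF kH(2)])
        show "near_odd_factor E U" if "odd_factor E H"
          using near_odd_factor_add_star4[OF disj(1) R(2) fin(1) finR star that vH] 4 U by (simp add: r_def)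
      qed (use cU 4 in simp)
      then show ?thesis using via_H[of 2] 4 by (auto simp: numeral_eq_Suc)
    next
      case 5
      have "bound U (kT + 3 * 2 + 1)"
      proof (rule step_odd[OF kT(2)])
        show "near_odd_factor E U" if "odd_factor E T"
          using near_odd_factor_add_leaves5[OF disj(2) R(2) fin(2) finR star that vT Tp] 5 U by (simp add: r_def)
      qed (use cU(1) 5 in simp)
      then show ?thesis using via_T[of 2] 5 by (auto simp: numeral_eq_Suc)
    next
      case 6
      have "bound U (kH + 3 * 3 + 1)"
      proof (rule step_odd[OF kH(2)])
        show "near_odd_factor E U" if "odd_factor E H"
          using near_odd_factor_add_star6[OF disj(1) R(2) fin(1) finR star that vH] 6 U by (simp add: r_def)
      qed (use cU 6 in simp)
      then show ?thesis using via_H[of 3] 6 by (auto simp: numeral_eq_Suc)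
    next
      case 7
      have "3 * card U div 2 = 3 * card H div 2 + 12" using cU 7 by linarith
      then have "bound U (kH + 11)" using kH(2) by (auto simp: bound_def)
      then show ?thesis using via_H[of 3] 7 by (auto simp: numeral_eq_Suc)
    next
      case 8
      \<comment> \<open>With \<open>c = h - 1\<close> the leaves cost at most
        \<open>3 * r / 2 - 1\<close>, a whole point below their share. This \<open>c\<close> is
        admissible since \<open>2 * r \<le> 4 * h + 2 < 5 * h \<le> h * (h + 1)\<close> for
        \<open>h \<ge> 4\<close>.\<close>
      define h where "h = r div 2"
      have h: "4 \<le> h" "2 * h \<le> r" "r \<le> 2 * h + 1" using 8 by (auto simp: h_def)
      have "2 * r < 5 * h" using h by linarith
      also have "\<dots> \<le> h * (h + 1)" using mult_le_mono2[of 5 "h + 1" h] h(1) by simp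
      finally have "2 * r < (h - 1 + 1) * (h - 1 + 2)" using h(1) by simp
      from via_T[OF this] have "painter_holds E U (kT + r + (h - 1))" .
      moreover have "bound U (kT + r + (h - 1))"
      proof -
        have "2 * kT \<le> 3 * card T" using kT(2) by (auto simp: bound_def)
        moreover have "2 * (kT + r + (h - 1)) + 2 = 2 * kT + 2 * r + 2 * h" using h(1) by simp
        ultimately have "2 * (kT + r + (h - 1)) + 2 \<le> 3 * card U" using h(2) cU(1) by linarith
        then show ?thesis by (auto simp: bound_def)
      qed
      ultimately show ?thesis by blast
    qed
  qed
  then show ?case by (simp add: bound_def)
qed

section \<open>Lister's strategies\<close>

text \<open>Additional edges only take answers away from Painter. Hence Lister may ignore edges in
  order to repair degrees.\<close>

lemma lister_forces_more_edges:
  "lister_forces F U k \<Longrightarrow> F \<subseteq> E \<Longrightarrow> lister_forces E U k"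
proof (induction rule: lister_forces.induct)
  case (1 U)
  then show ?case by (simp add: lister_forces.intros(1))
next
  case (2 M U k)
  show ?case
  proof (rule lister_forces.intros(2)[OF 2(1,2)])
    fix I assume I: "I \<subseteq> M" "independent E I"
    then have "independent F I" using 2(5) unfolding independent_def by blast
    then show "lister_forces E (U - I) (k - card M)" using 2(4)[OF I(1)] 2(5) by blast
  qed
qed

lemma lister_forces_superset:
  "lister_forces E U k \<Longrightarrow> U \<subseteq> W \<Longrightarrow> lister_forces E W k"
proof (induction arbitrary: W rule: lister_forces.induct)
  case (1 U)
  then show ?case by (simp add: lister_forces.intros(1))
next
  case (2 M U k)
  show ?case
  proof (rule lister_forces.intros(2)[of M])
    fix I assume "I \<subseteq> M" "independent E I"
    then show "lister_forces E (W - I) (k - card M)"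
      by (rule 2(4)) (use 2(5) in blast)
  qed (use 2 in auto)
qed

text \<open>Lister plays on \<open>A\<close> first and then on \<open>B\<close>; edges between the
  two are harmless because no mark meets both.\<close>

lemma lister_forces_Un:
  "lister_forces E A j \<Longrightarrow> lister_forces E B k \<Longrightarrow> A \<inter> B = {} \<Longrightarrow> lister_forces E (A \<union> B) (j + k)"
proof (induction rule: lister_forces.induct)
  case (1 U)
  then show ?case by (auto intro: lister_forces_superset)
next
  case (2 M U j)
  show ?case
  proof (rule lister_forces.intros(2)[of M])
    fix I assume I: "I \<subseteq> M" "independent E I"
    have "lister_forces E (U - I \<union> B) (j - card M + k)"
      by (rule 2(4)[OF I 2(5)]) (use 2(6) in auto)
    moreover have "U - I \<union> B = U \<union> B - I" using I 2(1,6) by blast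
    ultimately show "lister_forces E (U \<union> B - I) (j + k - card M)"
      using lister_forces_mono[of E "U \<union> B - I" "j - card M + k" "j + k - card M"] by simp
  qed (use 2(1,2) in auto)
qed

lemma lister_forces_card: "lister_forces E U (card U)"
proof (cases "U = {}")
  case True
  then show ?thesis by (simp add: lister_forces.intros(1))
next
  case False
  show ?thesis
    by (rule lister_forces.intros(2)[of U, OF _ False]) (auto intro: lister_forces.intros(1))
qed

text \<open>An answer containing \<open>v\<close> contains nothing else, and an answer inside
  \<open>R\<close> leaves at least \<open>U - R\<close> uncolored, so two positions suffice.\<close>

lemma lister_forces_mark_star:
  assumes "insert v R \<subseteq> U" "finite R" "v \<notin> R" "\<And>x. x \<in> R \<Longrightarrow> {v, x} \<in> E"
    and "lister_forces E (U - R) (k - (card R + 1))" "lister_forces E (U - {v}) (k - (card R + 1))"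
  shows "lister_forces E U k"
proof (rule lister_forces.intros(2)[OF assms(1)])
  fix I assume I: "I \<subseteq> insert v R" "independent E I"
  show "lister_forces E (U - I) (k - card (insert v R))"
  proof (cases "v \<in> I")
    case True
    then have "x \<notin> I" if "x \<in> R" for x
      using I(2) assms(4)[OF that] by (auto simp: independent_def)
    then have "I = {v}" using True I(1) by auto
    then show ?thesis using assms(2,3,6) by simp
  next
    case False
    then have "U - R \<subseteq> U - I" using I(1) by auto
    then show ?thesis using lister_forces_superset[OF assms(5)] assms(2,3) by simp
  qed
qed simp

lemma nbrs_delete:
  assumes "s \<noteq> x"
  shows "nbrs (F - {{s, x}}) U s = nbrs F U s - {x}"
    and "nbrs (F - {{s, x}}) U x = nbrs F U x - {s}"
    and "w \<noteq> s \<Longrightarrow> w \<noteq> x \<Longrightarrow> nbrs (F - {{s, x}}) U w = nbrs F U w"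
  using assms by (auto simp: doubleton_eq_iff)

lemma nbrs_Diff: "nbrs F (U - X) w = nbrs F U w - X"
  by auto

lemma nbrs_sym: "w \<in> U \<Longrightarrow> x \<in> nbrs F U w \<Longrightarrow> w \<in> nbrs F U x"
  by (simp add: insert_commute)

text \<open>At a vertex of degree 2 some edge can be deleted without increasing the number of vertices
  of even degree. When all degrees are odd (or 6), Lister marks a vertex \<open>v\<close> with two leaves;
  if Painter colors \<open>v\<close>, then only the parity of the remaining neighbor of \<open>v\<close> changes.\<close>

lemma lister_forces_degree_le_3:
  assumes "acyclic_edges F" "finite U"
    and "\<And>w. w \<in> U \<Longrightarrow> card (nbrs F U w) \<le> 3 \<or> w = s \<and> card (nbrs F U w) = 6"
    and "2 * k + card {w \<in> U. even (card (nbrs F U w))} \<le> 3 * card U"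
  shows "lister_forces F U k"
  using assms
\<comment> \<open>Edges are counted too, because the treatment of degree 2 deletes an edge and keeps
  \<open>U\<close>.\<close>
proof (induction "card U + card {e \<in> F. e \<subseteq> U}" arbitrary: F U k rule: less_induct)
  case less
  define D where "D w = card (nbrs F U w)" for w
  define Z where "Z = {w \<in> U. even (D w)}"
  have Z: "2 * k + card Z \<le> 3 * card U" using less.prems(4) by (simp add: Z_def D_def)
  have D: "D w \<le> 3 \<or> w = s \<and> D w = 6" if "w \<in> U" for w
    using less.prems(3) that by (simp add: D_def)
  have finN: "finite (nbrs F U w)" for w using less.prems(2) by simp
  have loop: "{x} \<notin> F" for x using less.prems(1) by (simp add: acyclic_edges_def)
  \<comment> \<open>The induction hypothesis with \<open>Y\<close> as an upper estimate for the set
    of even vertices.\<close>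
  have smaller_U: "lister_forces F' W j"
    if "W \<subset> U" "F' \<subseteq> F" "\<And>w. w \<in> W \<Longrightarrow> card (nbrs F' W w) \<le> 3 \<or> w = s \<and> card (nbrs F' W w) = 6"
      "{w \<in> W. even (card (nbrs F' W w))} \<subseteq> Y" "finite Y" "2 * j + card Y \<le> 3 * card W" for W F' Y j
  proof (rule less.hyps)
    have "card W < card U" using that(1) less.prems(2) by (rule psubset_card_mono[rotated])
    moreover have "finite {e \<in> F. e \<subseteq> U}"
      by (rule finite_subset[of _ "Pow U"]) (use less.prems(2) in auto)
    then have "card {e \<in> F'. e \<subseteq> W} \<le> card {e \<in> F. e \<subseteq> U}"
      by (rule card_mono) (use that(1,2) in auto)
    ultimately show "card W + card {e \<in> F'. e \<subseteq> W} < card U + card {e \<in> F. e \<subseteq> U}" by linarith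
    show "2 * j + card {w \<in> W. even (card (nbrs F' W w))} \<le> 3 * card W"
      using card_mono[OF that(5,4)] that(6) by linarith
    show "finite W" using that(1) less.prems(2) finite_subset by blast
  qed (use that acyclic_edges_subset[OF less.prems(1)] in auto)
  have D1: "nbrs F U v = {p}" if "D v = 1" "p \<in> nbrs F U v" for v p
    using that unfolding D_def by (metis card_1_singletonE singletonD)
  have finZ: "finite Z" using less.prems(2) by (simp add: Z_def)
  have "D w = 0 \<or> D w = 2 \<or> D w \<in> {1, 3} \<or> w = s \<and> D w = 6" if "w \<in> U" for w
    using D[OF that] by (cases "D w \<le> 3") (auto simp: numeral_eq_Suc le_Suc_eq)
  then consider (two) w where "w \<in> U" "D w = 2" | (zero) w where "w \<in> U" "D w = 0"
    | (odd) "\<And>w. w \<in> U \<Longrightarrow> D w \<in> {1, 3} \<or> w = s \<and> D w = 6"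
    by blast
  then show ?case
  proof cases
    case two
    \<comment> \<open>The far end of the deleted edge must not be \<open>s\<close>, whose degree
      might drop from 6 to 5. Since \<open>w\<close> turns odd, the possibly new even vertex
      \<open>x\<close> is paid for.\<close>
    have "\<not> nbrs F U w \<subseteq> {s}" using two(2) card_mono[of "{s}" "nbrs F U w"] by (auto simp: D_def)
    then obtain x where x: "x \<in> U" "{w, x} \<in> F" "x \<noteq> s" unfolding nbrs_def by blast
    have wx: "w \<noteq> x" using loop x(2) by auto
    let ?F = "F - {{w, x}}"
    note N = nbrs_delete[OF wx, where F = F and U = U]
    have Dw: "card (nbrs ?F U w) = 1" using two x N(1) finN[of w] by (simp add: D_def)
    have Dx: "card (nbrs ?F U x) = D x - 1"
      using two(1) x N(2) finN[of x] by (simp add: D_def insert_commute)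
    have Du: "card (nbrs ?F U u) = D u" if "u \<noteq> w" "u \<noteq> x" for u
      using N(3)[OF that] by (simp add: D_def)
    have wZ: "w \<in> Z" using two by (simp add: Z_def)
    show ?thesis
    proof (rule lister_forces_more_edges)
      show "lister_forces ?F U k"
      proof (rule less.hyps)
        have "{e \<in> ?F. e \<subseteq> U} \<subset> {e \<in> F. e \<subseteq> U}" using two(1) x by auto
        moreover have "finite {e \<in> F. e \<subseteq> U}"
          by (rule finite_subset[of _ "Pow U"]) (use less.prems(2) in auto)
        ultimately show "card U + card {e \<in> ?F. e \<subseteq> U} < card U + card {e \<in> F. e \<subseteq> U}"
          by (simp add: psubset_card_mono)
        show "acyclic_edges ?F" using acyclic_edges_subset[OF less.prems(1)] by blast
        show "finite U" by (rule less.prems(2))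
        show "card (nbrs ?F U u) \<le> 3 \<or> u = s \<and> card (nbrs ?F U u) = 6" if "u \<in> U" for u
          using Dw Dx Du[of u] D[OF that] x(3) by (cases "u = w"; cases "u = x") auto
        have "{u \<in> U. even (card (nbrs ?F U u))} \<subseteq> insert x (Z - {w})"
        proof
          fix u assume u: "u \<in> {u \<in> U. even (card (nbrs ?F U u))}"
          then have "u \<noteq> w" using Dw by auto
          then show "u \<in> insert x (Z - {w})" using u Du[of u] by (cases "u = x") (auto simp: Z_def)
        qed
        then have "card {u \<in> U. even (card (nbrs ?F U u))} \<le> card (insert x (Z - {w}))"
          by (rule card_mono[rotated]) (use finZ in simp)
        also have "\<dots> \<le> Suc (card (Z - {w}))" by (rule card_insert_le_m1) auto
        also have "\<dots> = card Z" using wZ finZ by (metis card.remove)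
        finally show "2 * k + card {u \<in> U. even (card (nbrs ?F U u))} \<le> 3 * card U"
          using Z by linarith
      qed
    qed auto
  next
    case zero
    have iso: "w \<notin> nbrs F U u" if "u \<in> U" for u
      using zero(2) that nbrs_sym[of u U w F] finN[of w] by (auto simp: D_def)
    have N: "nbrs F (U - {w}) u = nbrs F U u" if "u \<in> U - {w}" for u
      using iso[of u] that by (simp add: nbrs_Diff)
    have wZ: "w \<in> Z" using zero by (simp add: Z_def)
    \<comment> \<open>One vertex, one even vertex and one point fewer: both sides of the inequality
      drop by 3. The estimate \<open>card Z \<le> card U\<close> covers \<open>k = 0\<close>, where
      \<open>k - 1\<close> is truncated.\<close>
    have "lister_forces F (U - {w}) (k - 1)"
    proof (rule smaller_U[of _ _ "Z - {w}"])
      show "{u \<in> U - {w}. even (card (nbrs F (U - {w}) u))} \<subseteq> Z - {w}"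
        using N by (auto simp: Z_def D_def)
      show "card (nbrs F (U - {w}) u) \<le> 3 \<or> u = s \<and> card (nbrs F (U - {w}) u) = 6"
        if "u \<in> U - {w}" for u using N[OF that] D that by (auto simp: D_def)
      have "card Z \<le> card U" by (rule card_mono) (use less.prems(2) in \<open>auto simp: Z_def\<close>)
      then show "2 * (k - 1) + card (Z - {w}) \<le> 3 * card (U - {w})"
      proof -
        have "0 < card Z" "0 < card U" using wZ finZ zero(1) less.prems(2) by (auto simp: card_gt_0_iff)
        moreover have "card (Z - {w}) = card Z - 1" "card (U - {w}) = card U - 1"
          using wZ zero(1) by auto
        ultimately show ?thesis using Z \<open>card Z \<le> card U\<close> by linarith
      qed
    qed (use zero less.prems(2) finZ in auto)
    from lister_forces_Un[OF this lister_forces_card[of F "{w}"]]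
    have "lister_forces F (U - {w} \<union> {w}) (k - 1 + 1)" by simp
    moreover have "U - {w} \<union> {w} = U" using zero(1) by auto
    ultimately show ?thesis using lister_forces_mono[of F U "k - 1 + 1" k] by simp
  next
    case odd
    show ?thesis
    proof (cases "\<exists>v\<in>U. D v = 6 \<and> (\<forall>x\<in>nbrs F U v. nbrs F U x = {v})")
      case True
      then obtain v where v: "v \<in> U" "D v = 6" "\<And>x. x \<in> nbrs F U v \<Longrightarrow> nbrs F U x = {v}" by blast
      have vs: "v = s" using odd[OF v(1)] v(2) by auto
      have vZ: "v \<in> Z" using v by (simp add: Z_def)
      then have cZ: "1 \<le> card Z" using finZ by (simp add: Suc_le_eq card_gt_0_iff) blast
      \<comment> \<open>Up to truncation, the two answers require
        \<open>2 * (k - 4) \<le> 3 * (card U - 3)\<close>, with no even vertex left, and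
        \<open>2 * (k - 4) + 6 \<le> 3 * (card U - 1)\<close>, with six isolated vertices. Both
        amount to \<open>2 * k + 1 \<le> 3 * card U\<close>.\<close>
      obtain X where X: "X \<subseteq> nbrs F U v" "card X = 3"
        using obtain_subset_with_card_n[of 3 "nbrs F U v"] v(2) by (auto simp: D_def)
      have finX: "finite X" using X(1) finN finite_subset by blast
      have XU: "X \<subseteq> U" and vX: "v \<notin> X" using X(1) loop by auto
      have XE: "{v, x} \<in> F" if "x \<in> X" for x using X(1) that by auto
      have XN: "nbrs F U x = {v}" if "x \<in> X" for x using X(1) v(3) that by blast
      have cU: "6 \<le> card U" using v(2) card_mono[of U "nbrs F U v"] less.prems(2) by (auto simp: D_def nbrs_def)
      have Z1: "2 * k + 1 \<le> 3 * card U" using Z cZ by linarith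
      have Dodd: "D w \<in> {1, 3}" if "w \<in> U" "w \<noteq> v" for w using odd[OF that(1)] that(2) vs by auto
      have "lister_forces F (U - X) (k - 4)"
      proof (rule smaller_U[of _ _ "{}"])
        have "X \<noteq> {}" using X(2) by auto
        then show "U - X \<subset> U" using XU by blast
        have N: "nbrs F (U - X) w = nbrs F U w" if "w \<in> U - X" "w \<noteq> v" for w
        proof -
          have "x \<notin> nbrs F U w" if "x \<in> X" for x
            using XN[OF that] nbrs_sym[of w U x F] \<open>w \<in> U - X\<close> \<open>w \<noteq> v\<close> by blast
          then show ?thesis by (auto simp: nbrs_Diff)
        qed
        have Nv: "card (nbrs F (U - X) v) = 3"
          using X v(2) finX by (simp add: nbrs_Diff card_Diff_subset D_def)
        have deg: "card (nbrs F (U - X) w) \<in> {1, 3}" if "w \<in> U - X" for w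
          using Nv N[OF that] Dodd[of w] that unfolding D_def by (cases "w = v") auto
        show "card (nbrs F (U - X) w) \<le> 3 \<or> w = s \<and> card (nbrs F (U - X) w) = 6" if "w \<in> U - X" for w
          using deg[OF that] by auto
        show "{w \<in> U - X. even (card (nbrs F (U - X) w))} \<subseteq> {}"
          using deg by fastforce
        show "2 * (k - 4) + card ({} :: 'a set) \<le> 3 * card (U - X)"
          using Z1 X(2) XU finX by (simp add: card_Diff_subset)
      qed auto
      moreover have "lister_forces F (U - {v}) (k - 4)"
      proof (rule smaller_U[of _ _ "nbrs F U v"])
        show "card (nbrs F (U - {v}) w) \<le> 3 \<or> w = s \<and> card (nbrs F (U - {v}) w) = 6" if "w \<in> U - {v}" for w
        proof -
          have "card (nbrs F (U - {v}) w) \<le> D w"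
            unfolding nbrs_Diff D_def by (rule card_mono) (use finN in auto)
          then show ?thesis using Dodd[of w] that by auto
        qed
        show "{w \<in> U - {v}. even (card (nbrs F (U - {v}) w))} \<subseteq> nbrs F U v"
        proof
          fix w assume w: "w \<in> {w \<in> U - {v}. even (card (nbrs F (U - {v}) w))}"
          show "w \<in> nbrs F U v"
          proof (rule ccontr)
            assume "w \<notin> nbrs F U v"
            then have "v \<notin> nbrs F U w" using w nbrs_sym[of w U v F] by blast
            then have "nbrs F (U - {v}) w = nbrs F U w" by (simp add: nbrs_Diff)
            then show False using w Dodd[of w] by (auto simp: D_def)
          qed
        qed
        show "2 * (k - 4) + card (nbrs F U v) \<le> 3 * card (U - {v})"
          using Z1 cU v(1,2) less.prems(2) by (simp add: D_def)
      qed (use v(1) finN in auto)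
      ultimately show ?thesis
        using X(2) XU XE v(1) vX finX by (intro lister_forces_mark_star[of v X U F k]) auto
    next
      case False
      show ?thesis
      proof (cases "U = {}")
        case True
        then show ?thesis using Z by (simp add: lister_forces.intros(1))
      next
        case ne: False
        \<comment> \<open>A vertex of degree 6, if there is one, is taken as the root in
          \<open>stem_exists\<close>, so that \<open>v\<close> is another vertex and has odd degree.
          Degree 1 is possible only when the component is a single edge.\<close>
        obtain v p where v: "v \<in> U" and p: "p \<in> nbrs F U v"
          and leaf: "\<And>x. x \<in> nbrs F U v - {p} \<Longrightarrow> nbrs F U x = {v}"
          and v6: "D v \<noteq> 6" and v1: "D v = 1 \<Longrightarrow> nbrs F U p = {v}"
        proof (cases "\<exists>u\<in>U. D u = 6")
          case True
          then obtain u where u: "u \<in> U" "D u = 6" by blast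
          then have ne_nbrs: "nbrs F U u \<noteq> {}" by (auto simp: D_def)
          have "\<not> (\<forall>x\<in>nbrs F U u. nbrs F U x = {u})" using False u by blast
          with stem_exists[OF less.prems(1,2) u(1) ne_nbrs] obtain v p where
            v: "v \<in> U" "v \<noteq> u" "p \<in> nbrs F U v" "nbrs F U v \<noteq> {p}"
              "\<forall>x\<in>nbrs F U v - {p}. nbrs F U x = {v}" by blast
          have v6: "D v \<noteq> 6" using odd[OF v(1)] odd[OF u(1)] u(2) v(2) by auto
          have "D v \<noteq> 1" using D1[OF _ v(3)] v(4) by blast
          then show thesis by (intro that[OF v(1,3) bspec[OF v(5)] v6]) simp_all
        next
          case no6: False
          obtain u where u: "u \<in> U" using ne by blast
          have ne_nbrs: "nbrs F U u \<noteq> {}" using odd[OF u] by (auto simp: D_def)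
          from stem_exists[OF less.prems(1,2) u ne_nbrs] show thesis
          proof
            assume *: "\<forall>x\<in>nbrs F U u. nbrs F U x = {u}"
            obtain p where p: "p \<in> nbrs F U u" using ne_nbrs by blast
            have u6: "D u \<noteq> 6" using no6 u by blast
            show thesis by (rule that[OF u p bspec[OF *] u6 bspec[OF * p]]) (rule DiffD1)
          next
            assume "\<exists>v p. v \<in> U \<and> v \<noteq> u \<and> p \<in> nbrs F U v \<and> nbrs F U v \<noteq> {p} \<and>
              (\<forall>x\<in>nbrs F U v - {p}. nbrs F U x = {v})"
            then obtain v p where v: "v \<in> U" "p \<in> nbrs F U v" "nbrs F U v \<noteq> {p}"
              "\<forall>x\<in>nbrs F U v - {p}. nbrs F U x = {v}" by blast
            have v6: "D v \<noteq> 6" using no6 v(1) by blast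
            have "D v \<noteq> 1" using D1[OF _ v(2)] v(3) by blast
            then show thesis by (intro that[OF v(1,2) bspec[OF v(4)] v6]) simp_all
          qed
        qed
        have vp: "p \<noteq> v" "p \<in> U" "{v, p} \<in> F" using p loop by auto
        have "Z \<subseteq> {s}"
        proof
          fix w assume "w \<in> Z"
          then show "w \<in> {s}" using odd[of w] by (auto simp: Z_def)
        qed
        then have cZ: "card Z \<le> 1" using card_mono[of "{s}" Z] by simp
        consider "D v = 1" | "D v = 3" using odd[OF v] v6 by auto
        then show ?thesis
        proof cases
          case 1
          have Nv: "nbrs F U v = {p}" using D1[OF 1 p] .
          have Np: "nbrs F U p = {v}" using v1[OF 1] .
          define W where "W = U - {v, p}"
          have cW: "card W = card U - 2" "2 \<le> card U"
            using v vp less.prems(2) card_mono[of U "{v, p}"] by (auto simp: W_def card_Diff_subset)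
          have N: "nbrs F W w = nbrs F U w" if "w \<in> W" for w
          proof -
            have "v \<notin> nbrs F U w" "p \<notin> nbrs F U w"
              using that Nv Np nbrs_sym[of w U v F] nbrs_sym[of w U p F] by (auto simp: W_def)
            then show ?thesis by (auto simp: W_def nbrs_Diff)
          qed
          have "lister_forces F W (k - 3)"
          proof (rule smaller_U[of _ _ "Z \<inter> W"])
            show "card (nbrs F W w) \<le> 3 \<or> w = s \<and> card (nbrs F W w) = 6" if "w \<in> W" for w
              using N[OF that] D[of w] that by (auto simp: W_def D_def)
            show "{w \<in> W. even (card (nbrs F W w))} \<subseteq> Z \<inter> W"
              using N by (auto simp: Z_def D_def W_def)
            have "card (Z \<inter> W) \<le> card Z" "card (Z \<inter> W) \<le> card W"
              using finZ less.prems(2) by (auto intro!: card_mono simp: W_def)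
            then show "2 * (k - 3) + card (Z \<inter> W) \<le> 3 * card W"
              using Z cW by (cases "3 \<le> k") auto
          qed (use v finZ in \<open>auto simp: W_def\<close>)
          \<comment> \<open>Two points for marking both ends, and one more for an end that Painter
            has to leave.\<close>
          moreover have "lister_forces F {v, p} 3"
          proof (rule lister_forces_mark_star[of v "{p}"])
            have "{v, p} - {p} = {v}" "{v, p} - {v} = {p}" using vp(1) by auto
            then show "lister_forces F ({v, p} - {p}) (3 - (card {p} + 1))"
              "lister_forces F ({v, p} - {v}) (3 - (card {p} + 1))"
              using lister_forces_card[of F "{v}"] lister_forces_card[of F "{p}"] by simp_all
          qed (use vp in auto)
          ultimately have "lister_forces F (W \<union> {v, p}) (k - 3 + 3)"
            by (rule lister_forces_Un) (auto simp: W_def)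
          moreover have "W \<union> {v, p} = U" using v vp by (auto simp: W_def)
          ultimately show ?thesis using lister_forces_mono[of F U "k - 3 + 3" k] by simp
        next
          case 2
          define R where "R = nbrs F U v - {p}"
          have finR: "finite R" and cR: "card R = 2" and RU: "R \<subseteq> U" and vR: "v \<notin> R" and pR: "p \<notin> R"
            and RE: "\<And>x. x \<in> R \<Longrightarrow> {v, x} \<in> F"
            using 2 p finN[of v] loop by (auto simp: R_def D_def)
          have Nv: "nbrs F U v = insert p R" using p by (auto simp: R_def)
          have leafN: "x \<notin> nbrs F U w" if "x \<in> R" "w \<in> U" "w \<noteq> v" for x w
          proof
            assume "x \<in> nbrs F U w"
            then have "w \<in> nbrs F U x" by (rule nbrs_sym[OF that(2)])
            moreover have "nbrs F U x = {v}" using that(1) unfolding R_def by (rule leaf)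
            ultimately show False using that(3) by blast
          qed
          define W where "W = U - insert v R"
          have cU: "card (U - R) = card U - 2" "card W = card U - 3" "4 \<le> card U"
          proof -
            have "card (insert v (insert p R)) = 4" using cR finR vp(1) vR pR by simp
            then show "4 \<le> card U"
              using card_mono[of U "insert v (insert p R)"] v vp RU less.prems(2) by simp
          qed (use v RU vR finR cR in \<open>auto simp: W_def card_Diff_subset\<close>)
          have "lister_forces F (U - R) (k - 3)"
          proof (rule smaller_U[of _ _ Z])
            have "R \<noteq> {}" using cR by auto
            then show "U - R \<subset> U" using RU by blast
            have N: "nbrs F (U - R) w = nbrs F U w" if "w \<in> U - R" "w \<noteq> v" for w
              using leafN[of _ w] that unfolding nbrs_Diff by blast
            have "nbrs F (U - R) v = {p}" using Nv pR by (auto simp: nbrs_Diff)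
            then have Dv: "card (nbrs F (U - R) v) = 1" by simp
            show "card (nbrs F (U - R) w) \<le> 3 \<or> w = s \<and> card (nbrs F (U - R) w) = 6"
              if "w \<in> U - R" for w
              using N[OF that] Dv D[of w] that by (cases "w = v") (auto simp: D_def)
            show "{w \<in> U - R. even (card (nbrs F (U - R) w))} \<subseteq> Z"
            proof
              fix w assume w: "w \<in> {w \<in> U - R. even (card (nbrs F (U - R) w))}"
              then have "w \<noteq> v" using Dv by auto
              then show "w \<in> Z" using w N[of w] by (simp add: Z_def D_def)
            qed
            show "2 * (k - 3) + card Z \<le> 3 * card (U - R)"
              using Z cU(1,3) cZ by (cases "3 \<le> k") auto
          qed (use finZ in auto)
          moreover have "lister_forces F (U - {v}) (k - 3)"
          proof -
            have WU: "W \<subset> U" using v by (auto simp: W_def)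
            have pW: "p \<in> W" using vp pR by (simp add: W_def)
            have N: "nbrs F W w = nbrs F U w" if "w \<in> W" "w \<noteq> p" for w
            proof -
              have "v \<notin> nbrs F U w" using nbrs_sym[of w U v F] Nv that by (auto simp: W_def)
              moreover have "x \<notin> nbrs F U w" if "x \<in> R" for x
                using leafN[OF that] \<open>w \<in> W\<close> by (auto simp: W_def)
              ultimately show ?thesis unfolding W_def nbrs_Diff by blast
            qed
            have "v \<in> nbrs F U p" using nbrs_sym[OF v p] .
            moreover have "nbrs F W p = nbrs F U p - {v}"
              using leafN[of _ p] vp unfolding W_def nbrs_Diff by blast
            ultimately have Dp: "card (nbrs F W p) = D p - 1" using finN[of p] by (simp add: D_def)
            \<comment> \<open>The mark and the two now isolated leaves yield 5 points for three
              vertices, half a point more than 9/2; this is exactly what one new even vertex is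
              worth.\<close>
            have "lister_forces F W (k - 5)"
            proof (cases "D p = 6")
              case False
              show ?thesis
              proof (rule smaller_U[OF WU, of _ "insert p Z"])
                show "card (nbrs F W w) \<le> 3 \<or> w = s \<and> card (nbrs F W w) = 6" if "w \<in> W" for w
                  using N[OF that] Dp False D[of w] that WU by (cases "w = p") (auto simp: D_def)
                show "{w \<in> W. even (card (nbrs F W w))} \<subseteq> insert p Z"
                  using N WU by (auto simp: Z_def D_def)
                have "card (insert p Z) \<le> card Z + 1" by (simp add: card_insert_if finZ)
                then show "2 * (k - 5) + card (insert p Z) \<le> 3 * card W"
                  using Z cU cZ by (cases "5 \<le> k") auto
              qed (use finZ in auto)
            next
              \<comment> \<open>The degree of \<open>p\<close> has become 5, which is not
                admissible. Deleting two more edges at \<open>p\<close> makes it 3; \<open>x\<close>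
                and \<open>y\<close> may turn even, but \<open>p\<close> was even before, so the
                count grows by at most one.\<close>
              case True
              then have ps: "p = s" using odd[OF vp(2)] by auto
              have "p \<in> Z" using True vp by (simp add: Z_def)
              then have Z1: "2 * k + 1 \<le> 3 * card U" using Z finZ cZ
                by (metis One_nat_def Suc_leI add_le_cancel_left card_gt_0_iff empty_iff le_trans)
              have c5: "card (nbrs F W p) = 5" using Dp True by simp
              obtain X where X: "X \<subseteq> nbrs F W p" "card X = 2"
                using obtain_subset_with_card_n[of 2 "nbrs F W p"] c5 by auto
              then obtain x y where xy: "X = {x, y}" "x \<noteq> y" by (auto simp: card_2_iff)
              have xp: "p \<noteq> x" "p \<noteq> y" and xN: "x \<in> nbrs F W p" "y \<in> nbrs F W p"
                using X(1) xy loop by auto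
              let ?F1 = "F - {{p, x}}" and ?F2 = "F - {{p, x}} - {{p, y}}"
              note N1 = nbrs_delete[OF xp(1), where F = F and U = W]
              note N2 = nbrs_delete[OF xp(2), where F = ?F1 and U = W]
              have finW: "finite (nbrs F W w)" for w using less.prems(2) by (simp add: W_def)
              have "nbrs ?F2 W p = nbrs F W p - X" using N1 N2 xy by auto
              then have Dp3: "card (nbrs ?F2 W p) = 3"
                using X c5 xy by (simp add: card_Diff_subset)
              have sub: "card (nbrs ?F2 W w) \<le> card (nbrs F W w)" for w
                by (rule card_mono[OF finW]) (auto simp: nbrs_def)
              have Doth: "card (nbrs F W w) \<in> {1, 3}" if "w \<in> W" "w \<noteq> p" for w
                using N[OF that] odd[of w] that WU ps by (auto simp: D_def)
              have "lister_forces ?F2 W (k - 5)"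
              proof (rule smaller_U[OF WU, of _ "{x, y}"])
                show "card (nbrs ?F2 W w) \<le> 3 \<or> w = s \<and> card (nbrs ?F2 W w) = 6" if "w \<in> W" for w
                  using Dp3 sub[of w] Doth[OF that] by (cases "w = p") auto
                show "{w \<in> W. even (card (nbrs ?F2 W w))} \<subseteq> {x, y}"
                proof
                  fix w assume w: "w \<in> {w \<in> W. even (card (nbrs ?F2 W w))}"
                  show "w \<in> {x, y}"
                  proof (rule ccontr)
                    assume "w \<notin> {x, y}"
                    moreover have "w \<noteq> p" using w Dp3 by auto
                    ultimately have "nbrs ?F2 W w = nbrs F W w" using N1(3) N2(3) by simp
                    then show False using w Doth[of w] \<open>w \<noteq> p\<close> by auto
                  qed
                qed
                show "2 * (k - 5) + card {x, y} \<le> 3 * card W"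
                  using Z1 cU xy(2) by (cases "5 \<le> k") auto
              qed auto
              then show ?thesis by (rule lister_forces_more_edges) auto
            qed
            from lister_forces_Un[OF this lister_forces_card[of F R]]
            have "lister_forces F (W \<union> R) (k - 5 + 2)" using cR by (auto simp: W_def)
            moreover have "W \<union> R = U - {v}" using RU vR by (auto simp: W_def)
            ultimately show ?thesis
              using lister_forces_mono[of F "U - {v}" "k - 5 + 2" "k - 3"] by simp
          qed
          ultimately show ?thesis
            using v RU finR vR RE cR by (intro lister_forces_mark_star[of v R U F k]) auto
        qed
      qed
    qed
  qed
qed

section \<open>The value of the game on a forest\<close>

text \<open>The value is guaranteed by both players, and no guarantee of Lister exceeds one of
  Painter.\<close>

lemma sum_color_cost_bounds:
  assumes "simple_graph V E"
  shows "painter_holds E V k \<Longrightarrow> sum_color_cost V E \<le> k"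
    and "lister_forces E V k \<Longrightarrow> k \<le> sum_color_cost V E"
proof -
  let ?c = "sum_color_cost V E"
  have fin: "finite V" using assms by (simp add: simple_graph_def)
  have c: "painter_holds E V ?c \<and> lister_forces E V ?c"
    unfolding sum_color_cost_def by (rule theI'[OF game_value_ex1[OF assms]])
  have le: "i \<le> j" if "painter_holds E V j" "lister_forces E V i" for i j
    using that game_determined[OF fin] lister_forces_mono[of E V i "Suc j"] by (meson not_less_eq_eq)
  show "painter_holds E V k \<Longrightarrow> ?c \<le> k" using c le by blast
  show "lister_forces E V k \<Longrightarrow> k \<le> ?c" using c le by blast
qed

lemma acyclic_edges_forest: "forest V E \<Longrightarrow> acyclic_edges E"
  unfolding forest_def simple_graph_def acyclic_edges_def by force

lemma degree_eq_card_nbrs: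
  assumes "simple_graph V F" "v \<in> V"
  shows "degree F v = card (nbrs F V v)"
proof -
  have "{e \<in> F. v \<in> e} = (\<lambda>w. {v, w}) ` nbrs F V v"
  proof (intro equalityI subsetI)
    fix e assume "e \<in> {e \<in> F. v \<in> e}"
    then have e: "e \<in> F" "v \<in> e" "card e = 2" "e \<subseteq> V"
      using assms(1) by (auto simp: simple_graph_def)
    then obtain w where "e = {v, w}" by (auto simp: card_2_iff)
    then show "e \<in> (\<lambda>w. {v, w}) ` nbrs F V v" using e by auto
  qed auto
  moreover have "inj_on (\<lambda>w. {v, w}) (nbrs F V v)" by (auto simp: inj_on_def doubleton_eq_iff)
  ultimately show ?thesis by (simp add: degree_def card_image)
qed

lemma spanning_forest_subset:
  assumes "forest V E" "F \<subseteq> E"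
  shows "spanning_forest V E F"
  using assms unfolding spanning_forest_def forest_def simple_graph_def is_cycle_def by blast

theorem theorem4p1:
  fixes V :: "'a set" and E :: "'a set set" and n :: nat
  assumes "forest V E"
    and "card V = n"
  shows "sum_color_cost V E \<le> (3 * n) div 2 \<and>
    (sum_color_cost V E = (3 * n) div 2 \<longleftrightarrow>
      (\<exists>F. spanning_forest V E F \<and>
        (even n \<longrightarrow> (\<forall>v\<in>V. degree F v \<in> {1, 3})) \<and>
        (odd n \<longrightarrow>
          (\<exists>!v. v \<in> V \<and> degree F v \<in> {0, 6}) \<and>
          (\<forall>v\<in>V. degree F v \<notin> {0, 6} \<longrightarrow> degree F v \<in> {1, 3}))))"
    (is "?le \<and> (?eq \<longleftrightarrow> (\<exists>F. ?good F))")
proof -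
  have simple: "simple_graph V E" and fin: "finite V"
    using assms(1) by (auto simp: forest_def simple_graph_def)
  note bounds = sum_color_cost_bounds[OF simple]
  obtain k where k: "painter_holds E V k" "k < 3 * n div 2 \<or> k = 3 * n div 2 \<and>
      (if even n then odd_factor E V else near_odd_factor E V)"
    using painter_holds_forest[OF acyclic_edges_forest[OF assms(1)] fin] assms(2) by blast
  have deg: "degree F v = card (nbrs F V v)" if "F \<subseteq> E" "v \<in> V" for F v
    using degree_eq_card_nbrs[of V F v] spanning_forest_subset[OF assms(1) that(1)] that(2)
    by (simp add: spanning_forest_def forest_def)
  have le: ?le using bounds(1)[OF k(1)] k(2) by auto
  have factor: "\<exists>F. ?good F" if ?eq
  proof -
    have parity_factor: "if even n then odd_factor E V else near_odd_factor E V"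
      using that bounds(1)[OF k(1)] k(2) by auto
    show ?thesis
    proof (cases "even n")
      case True
      with parity_factor obtain F where F: "F \<subseteq> E" "\<forall>w\<in>V. card (nbrs F V w) \<in> {1, 3}"
        by (auto simp: odd_factor_def)
      then have "?good F"
        using True spanning_forest_subset[OF assms(1) F(1)] deg[OF F(1)] by simp
      then show ?thesis by blast
    next
      case False
      with parity_factor obtain F s where F: "F \<subseteq> E" and s: "s \<in> V" "card (nbrs F V s) \<in> {0, 6}"
        "\<forall>w\<in>V - {s}. card (nbrs F V w) \<in> {1, 3}"
        unfolding near_odd_factor_def by auto
      have ds: "degree F s \<in> {0, 6}" using s deg[OF F] by simp
      have dw: "degree F w \<in> {1, 3}" if "w \<in> V" "w \<noteq> s" for w using s(3) that deg[OF F] by simp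
      then have "degree F w \<notin> {0, 6}" if "w \<in> V" "w \<noteq> s" for w using that by fastforce
      then have "\<exists>!v. v \<in> V \<and> degree F v \<in> {0, 6}" using s(1) ds by blast
      moreover have "\<forall>v\<in>V. degree F v \<notin> {0, 6} \<longrightarrow> degree F v \<in> {1, 3}" using ds dw by blast
      ultimately have "?good F" using False spanning_forest_subset[OF assms(1) F] by blast
      then show ?thesis by blast
    qed
  qed
  have eq: ?eq if good: "?good F" for F
  proof -
    have FE: "F \<subseteq> E" and ac: "acyclic_edges F"
      using good acyclic_edges_forest by (auto simp: spanning_forest_def)
    let ?D = "\<lambda>w. card (nbrs F V w)"
    \<comment> \<open>\<open>s\<close> is the only vertex that may have degree 6; for even
      \<open>n\<close> there is none and any \<open>s\<close> serves. For odd \<open>n\<close> one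
      even degree is affordable, since \<open>3 * n\<close> is odd and the floor leaves a remainder
      of 1.\<close>
    obtain s where s: "\<And>w. w \<in> V \<Longrightarrow> ?D w \<le> 3 \<or> w = s \<and> ?D w = 6"
      "2 * (3 * n div 2) + card {w \<in> V. even (?D w)} \<le> 3 * n"
    proof (cases "even n")
      case True
      then have D: "?D w \<in> {1, 3}" if "w \<in> V" for w using good that deg[OF FE] by simp
      then have "{w \<in> V. even (?D w)} = {}" by fastforce
      then have "card {w \<in> V. even (?D w)} = 0" by (simp only: card.empty)
      then have "2 * (3 * n div 2) + card {w \<in> V. even (?D w)} \<le> 3 * n" by linarith
      moreover have "?D w \<le> 3" if "w \<in> V" for w using D[OF that] by auto
      ultimately show thesis using that by blast
    next
      case False
      then obtain s where s: "s \<in> V" "?D s \<in> {0, 6}"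
        and u: "\<And>w. w \<in> V \<Longrightarrow> ?D w \<in> {0, 6} \<Longrightarrow> w = s"
        and o: "\<And>w. w \<in> V \<Longrightarrow> ?D w \<notin> {0, 6} \<Longrightarrow> ?D w \<in> {1, 3}"
        using good deg[OF FE] by (metis (no_types, lifting))
      have "?D w \<in> {1, 3}" if "w \<in> V" "w \<noteq> s" for w using u o that by blast
      then have D: "?D w = 1 \<or> ?D w = 3" if "w \<in> V" "w \<noteq> s" for w using that by auto
      have "{w \<in> V. even (?D w)} \<subseteq> {s}"
      proof
        fix w assume "w \<in> {w \<in> V. even (?D w)}"
        then show "w \<in> {s}" using D[of w] by (cases "w = s") auto
      qed
      then have "card {w \<in> V. even (?D w)} \<le> 1" using card_mono[of "{s}"] by fastforce
      moreover have "2 * (3 * n div 2) + 1 = 3 * n" using False by presburger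
      ultimately have "2 * (3 * n div 2) + card {w \<in> V. even (?D w)} \<le> 3 * n" by linarith
      moreover have "?D w \<le> 3 \<or> w = s \<and> ?D w = 6" if "w \<in> V" for w
        using D[OF that] s by (cases "w = s") auto
      ultimately show thesis using that by blast
    qed
    have "lister_forces F V (3 * n div 2)"
      by (rule lister_forces_degree_le_3[OF ac fin s(1)]) (use s(2) assms(2) in auto)
    then have "lister_forces E V (3 * n div 2)" using FE by (rule lister_forces_more_edges)
    then show ?eq using bounds(2) le by (simp add: le_antisym)
  qed
  show ?thesis
  proof (intro conjI iffI le)
    show "\<exists>F. ?good F" if ?eq using that by (rule factor)
    show ?eq if "\<exists>F. ?good F" using that by (rule exE) (rule eq)
  qed
qed

end
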